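(* Let ${\bf p}(t)=\{p_n(t)\}_{n\geq 0}$ be a classical solution of $\frac{\mathrm{d}}{\mathrm{d}t}{\bf p}(t)=\mathcal{L}[{\bf p}(t)]$ with ${\bf p}(0)\in\mathcal{A}$. There exist fixed $k_1>0$ and $k_2>0$ such that for all $t\geq 0$ we have $$\frac{\mathrm{d}}{\mathrm{d}t}\widetilde{\mathcal{H}}_{ab}[{\bf p}]\leq 0,$$ where $\widetilde{\mathcal{H}}_{ab}$ is the functional defined with these weights $k_1,k_2$. Moreover, $\frac{\mathrm{d}}{\mathrm{d}t}\widetilde{\mathcal{H}}_{ab}[{\bf p}]=0$ if and only if ${\bf p}$ coincides with the equilibrium ${\bf p}^*$. Consequently, ${\bf p}(t)\to{\bf p}^*$ as $t\to\infty$ strongly in $\ell^p$ for each $1<p<\infty$.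
   Context: Here $\mathbb{N}=\{0,1,2,\dots\}$ and $\mathbb{N}_+=\{1,2,\dots\}$. Fix $a\in\mathbb{N}$ and $b,\mu\in\mathbb{N}_+$ with $a<\mu<b$. For a probability mass function ${\bf p}=(p_0,p_1,\dots)$ on $\mathbb{N}$ put $\lambda_r=\sum_{0\leq\ell\leq b-1}p_\ell$, $\lambda_g=\sum_{\ell\geq a+1}p_\ell$, and for $n\in\mathbb{N}$ $$\mathcal{L}[{\bf p}]_n=\lambda_r\left(\mathbf{1}_{\{a\leq n\}}p_{n+1}-\mathbf{1}_{\{a+1\leq n\}}p_n\right)+\lambda_g\left(\mathbf{1}_{\{1\leq n\leq b\}}p_{n-1}-\mathbf{1}_{\{n\leq b-1\}}p_n\right).$$ A classical solution of $\frac{\mathrm{d}}{\mathrm{d}t}{\bf p}=\mathcal{L}[{\bf p}]$ is a family of probability mass functions ${\bf p}(t)$, $t\geq 0$, whose components are continuously differentiable in $t$ and satisfy $p_n'(t)=\mathcal{L}[{\bf p}(t)]_n$ for all $n\in\mathbb{N}$, $t\geq 0$. Let $V_\mu=\{{\bf p}\mid\sum_{n\geq 0}p_n=1,\ p_n\geq 0,\ \sum_{n\geq 0}n\,p_n=\mu\}$ and $\mathcal{A}=\{{\bf p}\in V_\mu\mid\sum_{n\geq 0}2^n p_n<\infty\}$. The equilibrium ${\bf p}^*$ is defined by $p_n^*=\overline{r}^{\,n-a}p_a^*$ for $a\leq n\leq b$ and $p_n^*=0$ for $n<a$ or $n>b$, where $\overline{r}>0$ and $p_a^*>0$ are the (uniquely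 determined) constants for which ${\bf p}^*\in V_\mu$. For $k_1,k_2>0$ the functional is $$\widetilde{\mathcal{H}}_{ab}[{\bf p}]=\sum_{n=0}^{a-1}p_n+\sum_{n=a}^{b}p_n\log p_n+\sum_{n=b+1}^{\infty}p_n+k_1\sum_{n=b+1}^{\infty}n\,p_n+k_2\sum_{n=0}^{a-1}(a-n)\,p_n,$$ with the convention $0\log 0=0$; $\frac{\mathrm{d}}{\mathrm{d}t}\widetilde{\mathcal{H}}_{ab}[{\bf p}]$ denotes the time derivative of $t\mapsto\widetilde{\mathcal{H}}_{ab}[{\bf p}(t)]$ along the solution.
   Formalization: The time derivative is one-sided at t=0 and may equal −∞ there when p_n(0)=0 for some a≤n≤b (e.g. a=0, b=2, μ=1, p(0) a point mass at 1, where no finite derivative exists); for all other t it is an ordinary finite derivative. *)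

theory Defs
  imports "HOL-Analysis.Analysis"
begin

definition lambda_r :: "nat \<Rightarrow> (nat \<Rightarrow> real) \<Rightarrow> real" where
  "lambda_r b p = (\<Sum>l<b. p l)"

definition lambda_g :: "nat \<Rightarrow> (nat \<Rightarrow> real) \<Rightarrow> real" where
  "lambda_g a p = (\<Sum>l. p (l + (a + 1)))"

text \<open>For \<open>n = 0\<close> the truncated \<open>n - 1\<close> is harmless, since its indicator vanishes.\<close>

definition exchange_op :: "nat \<Rightarrow> nat \<Rightarrow> (nat \<Rightarrow> real) \<Rightarrow> nat \<Rightarrow> real" where
  "exchange_op a b p n =
     lambda_r b p * (of_bool (a \<le> n) * p (n + 1) - of_bool (a + 1 \<le> n) * p n)
   + lambda_g a p * (of_bool (1 \<le> n \<and> n \<le> b) * p (n - 1) - of_bool (n + 1 \<le> b) * p n)"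

definition prob_seq :: "(nat \<Rightarrow> real) \<Rightarrow> bool" where
  "prob_seq p \<longleftrightarrow> (\<forall>n. 0 \<le> p n) \<and> p sums 1"

text \<open>Differentiability and continuity are relative to the time domain \<open>{0..}\<close>, hence
  one-sided at \<open>t = 0\<close>. Values of \<open>p\<close> at negative times are irrelevant.\<close>

definition classical_solution :: "nat \<Rightarrow> nat \<Rightarrow> (real \<Rightarrow> nat \<Rightarrow> real) \<Rightarrow> bool" where
  "classical_solution a b p \<longleftrightarrow>
     (\<forall>t\<ge>0. prob_seq (p t)) \<and>
     (\<forall>n. \<forall>t\<ge>0. ((\<lambda>s. p s n) has_real_derivative exchange_op a b (p t) n) (at t within {0..})) \<and>
     (\<forall>n. continuous_on {0..} (\<lambda>t. exchange_op a b (p t) n))"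

definition V_space :: "nat \<Rightarrow> (nat \<Rightarrow> real) set" where
  "V_space \<mu> = {p. prob_seq p \<and> (\<lambda>n. real n * p n) sums real \<mu>}"

definition A_space :: "nat \<Rightarrow> (nat \<Rightarrow> real) set" where
  "A_space \<mu> = {p \<in> V_space \<mu>. summable (\<lambda>n. 2 ^ n * p n)}"

definition equilibrium :: "nat \<Rightarrow> nat \<Rightarrow> nat \<Rightarrow> nat \<Rightarrow> real" where
  "equilibrium a b \<mu> =
     (THE q. q \<in> V_space \<mu> \<and>
        (\<exists>r>0. \<exists>c>0. q = (\<lambda>n. if a \<le> n \<and> n \<le> b then r ^ (n - a) * c else 0)))"

text \<open>The convention \<open>0 log 0 = 0\<close> holds because of the factor \<open>p n\<close>.\<close>

definition H_functional :: "nat \<Rightarrow> nat \<Rightarrow> real \<Rightarrow> real \<Rightarrow> (nat \<Rightarrow> real) \<Rightarrow> real" where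
  "H_functional a b k1 k2 p =
     (\<Sum>n<a. p n) + (\<Sum>n=a..b. p n * ln (p n)) + (\<Sum>n. p (n + (b + 1)))
   + k1 * (\<Sum>n. real (n + (b + 1)) * p (n + (b + 1)))
   + k2 * (\<Sum>n<a. (real a - real n) * p n)"

text \<open>Derivative of a function on the time domain \<open>{0..}\<close> as an extended real number. A finite
  \<open>D\<close> is the ordinary derivative (one-sided at \<open>0\<close>). Infinite values are needed at
  \<open>t = 0\<close>: if \<open>p 0 n = 0\<close> for some \<open>n \<in> {a..b}\<close> into which mass flows, then
  \<open>p t n * ln (p t n)\<close> has slope \<open>-\<infinity>\<close> there, for instance when the initial state is
  a point mass.\<close>

definition has_time_derivative :: "(real \<Rightarrow> real) \<Rightarrow> ereal \<Rightarrow> real \<Rightarrow> bool" where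
  "has_time_derivative f D t \<longleftrightarrow>
     ((\<lambda>s. ereal ((f s - f t) / (s - t))) \<longlongrightarrow> D) (at t within {0..})"

lemma has_time_derivative_ereal_iff:
  "has_time_derivative f (ereal d) t \<longleftrightarrow> (f has_real_derivative d) (at t within {0..})"
  by (simp add: has_time_derivative_def has_field_derivative_iff)

definition lp_space :: "real \<Rightarrow> (nat \<Rightarrow> real) set" where
  "lp_space q = {x. summable (\<lambda>n. \<bar>x n\<bar> powr q)}"

definition lp_norm :: "real \<Rightarrow> (nat \<Rightarrow> real) \<Rightarrow> real" where
  "lp_norm q x = (\<Sum>n. \<bar>x n\<bar> powr q) powr (1 / q)"

definition lp_tendsto :: "real \<Rightarrow> (real \<Rightarrow> nat \<Rightarrow> real) \<Rightarrow> (nat \<Rightarrow> real) \<Rightarrow> bool" where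
  "lp_tendsto q p x \<longleftrightarrow>
     x \<in> lp_space q \<and> (\<forall>t\<ge>0. p t \<in> lp_space q) \<and>
     ((\<lambda>t. lp_norm q (\<lambda>n. p t n - x n)) \<longlongrightarrow> 0) at_top"

end

theory Submission
  imports Defs
begin

text \<open>
  With \<open>tail q N\<close> the mass at or above \<open>N\<close>, the tails beyond \<open>b\<close> decrease in time. So the first
  moments stay uniformly integrable, the mean is conserved, and both rates stay above a constant
  \<open>c > 0\<close>. Summation by parts turns the time derivative of the functional into a
  sum over \<open>a \<le> n < b\<close> of terms \<open>-(x - y) (ln x - ln y)\<close> with \<open>x = \<lambda>\<^sub>r p (n + 1)\<close>, \<open>y = \<lambda>\<^sub>g p n\<close>, plus
  boundary terms of favourable sign, plus \<open>(\<lambda>\<^sub>g A - \<lambda>\<^sub>r T) (ln \<lambda>\<^sub>r - ln \<lambda>\<^sub>g)\<close>, where \<open>A\<close> and \<open>T\<close> are the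
  masses below \<open>a\<close> and above \<open>b\<close>; the last term is absorbed by the choice \<open>k1 = k2 = 1 - ln c\<close>.
  Hence the squared fluxes, \<open>A\<close> and \<open>T\<close> are dissipated. Being Lipschitz in time, they tend to \<open>0\<close>.
  In the limit the profile on \<open>[a, b]\<close> is geometric, and its ratio is determined by the mean.
\<close>

section \<open>Tails and fluxes of a state\<close>

text \<open>The functional contains two infinite sums, and differentiating them term by term along
  the flow is not justified beforehand. Conservation of mass and mean turns them into constants
  minus finite sums. The mean must therefore be treated first; its conservation is not automatic,
  since part of it could escape to infinity. Tails are the convenient coordinates: each changes by a
  single flux, and the mean is the sum of the tails from level \<open>1\<close> on.

  Inside the logarithms the components are multiplied by the rates, and the logarithms of the two
  rates do not cancel. Both rates lie in \<open>[c, 1]\<close>, so these logarithms differ by at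
  most \<open>- ln c\<close>. The further \<open>1\<close> in the weights leaves a genuine
  dissipation of the mass outside \<open>[a, b]\<close>. The constant \<open>c\<close> depends on
  the initial data, hence so do the weights.

  At time \<open>0\<close> components in \<open>[a, b]\<close> may vanish, and there the entropy
  need not have a finite slope. At positive times all of them are positive, so only the initial time
  needs a separate treatment.\<close>

definition tail :: "(nat \<Rightarrow> real) \<Rightarrow> nat \<Rightarrow> real" where
  "tail q N = 1 - (\<Sum>n<N. q n)"

lemma tail_0 [simp]: "tail q 0 = 1"
  by (simp add: tail_def)

lemma tail_Suc: "tail q (Suc N) = tail q N - q N"
  by (simp add: tail_def)

lemma tail_sums:
  assumes "prob_seq q"
  shows "(\<lambda>n. q (n + N)) sums tail q N"
  using assms sums_iff_shift[of q N "tail q N"] by (simp add: tail_def prob_seq_def)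

lemma tail_eq_suminf:
  assumes "prob_seq q"
  shows "tail q N = (\<Sum>n. q (n + N))"
  using tail_sums[OF assms] by (simp add: sums_iff)

lemma prob_seq_nonneg: "prob_seq q \<Longrightarrow> 0 \<le> q n"
  by (simp add: prob_seq_def)

lemma tail_nonneg:
  assumes "prob_seq q"
  shows "0 \<le> tail q N"
  using tail_sums[OF assms, of N] prob_seq_nonneg[OF assms]
  by (metis sums_iff suminf_nonneg)

lemma tail_antimono:
  assumes "prob_seq q" "M \<le> N"
  shows "tail q N \<le> tail q M"
  using assms(2) by (rule lift_Suc_antimono_le[rotated])
    (simp add: tail_Suc prob_seq_nonneg[OF assms(1)])

lemma tail_le_1: "prob_seq q \<Longrightarrow> tail q N \<le> 1"
  using tail_antimono[of q 0 N] by simp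

lemma prob_seq_le_tail: "prob_seq q \<Longrightarrow> q N \<le> tail q N"
  using tail_nonneg[of q "Suc N"] by (simp add: tail_Suc)

lemma prob_seq_le_1: "prob_seq q \<Longrightarrow> q N \<le> 1"
  using prob_seq_le_tail tail_le_1 order_trans by blast

lemma lambda_r_tail: "lambda_r b q = 1 - tail q b"
  by (simp add: lambda_r_def tail_def)

lemma lambda_g_tail: "prob_seq q \<Longrightarrow> lambda_g a q = tail q (Suc a)"
  by (simp add: lambda_g_def tail_eq_suminf)

lemma lambda_bounds:
  assumes "prob_seq q"
  shows "0 \<le> lambda_r b q" "lambda_r b q \<le> 1" "0 \<le> lambda_g a q" "lambda_g a q \<le> 1"
  using assms by (auto simp: lambda_r_tail lambda_g_tail tail_nonneg tail_le_1)

lemma sum_tail_Suc: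
  "(\<Sum>N<K. tail q (Suc N)) = (\<Sum>n<K. real n * q n) + real K * tail q K"
  by (induction K) (simp_all add: tail_Suc algebra_simps)

text \<open>Summation by parts leaves the boundary term \<open>real K * tail q K\<close>. It is at
  most the remainder of the moment series from \<open>K\<close> on, hence tends to
  \<open>0\<close>.\<close>

lemma first_moment_imp_tail_sums:
  assumes q: "prob_seq q" and m: "(\<lambda>n. real n * q n) sums m"
  shows "(\<lambda>N. tail q (Suc N)) sums m"
proof -
  define M where "M K = m - (\<Sum>n<K. real n * q n)" for K
  have Mlim: "M \<longlonglongrightarrow> 0"
    using m unfolding M_def sums_def by (auto intro!: tendsto_eq_intros)
  have "real K * tail q K \<le> M K" for K
  proof (rule sums_le)
    show "(\<lambda>n. real K * q (n + K)) sums (real K * tail q K)"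
      by (intro sums_mult tail_sums q)
    show "(\<lambda>n. real (n + K) * q (n + K)) sums M K"
      using sums_iff_shift[of "\<lambda>n. real n * q n" K] m by (simp add: M_def)
    show "real K * q (n + K) \<le> real (n + K) * q (n + K)" for n
      using prob_seq_nonneg[OF q] by (intro mult_right_mono) auto
  qed
  moreover have "0 \<le> real K * tail q K" for K
    using tail_nonneg[OF q] by simp
  ultimately have "(\<lambda>K. real K * tail q K) \<longlonglongrightarrow> 0"
    by (intro tendsto_sandwich[OF _ _ tendsto_const Mlim]) auto
  from tendsto_add[OF m[unfolded sums_def] this] show ?thesis
    by (simp add: sums_def sum_tail_Suc)
qed

lemma tail_sums_iff_first_moment:
  assumes q: "prob_seq q"
  shows "(\<lambda>N. tail q (Suc N)) sums m \<longleftrightarrow> (\<lambda>n. real n * q n) sums m"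
proof
  assume m: "(\<lambda>N. tail q (Suc N)) sums m"
  have "summable (\<lambda>n. real n * q n)"
  proof (rule summableI_nonneg_bounded)
    show "0 \<le> real n * q n" for n
      using prob_seq_nonneg[OF q] by simp
    fix K
    have "(\<Sum>n<K. real n * q n) \<le> (\<Sum>N<K. tail q (Suc N))"
      using tail_nonneg[OF q] by (simp add: sum_tail_Suc)
    also have "\<dots> \<le> m"
      using m tail_nonneg[OF q] by (metis sums_iff sum_le_suminf finite_lessThan)
    finally show "(\<Sum>n<K. real n * q n) \<le> m" .
  qed
  then obtain m' where m': "(\<lambda>n. real n * q n) sums m'"
    by (auto simp: summable_def)
  then show "(\<lambda>n. real n * q n) sums m"
    using first_moment_imp_tail_sums[OF q m'] m sums_unique2 by blast
qed (rule first_moment_imp_tail_sums[OF q])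

text \<open>The net downward flow of mass from \<open>N\<close> to \<open>N - 1\<close>.\<close>

definition flux :: "nat \<Rightarrow> nat \<Rightarrow> (nat \<Rightarrow> real) \<Rightarrow> nat \<Rightarrow> real" where
  "flux a b q N =
     lambda_r b q * (of_bool (a < N) * q N)
   - lambda_g a q * (of_bool (1 \<le> N \<and> N \<le> b) * q (N - 1))"

text \<open>In this form the dynamics is a discrete divergence: sums over blocks of sites reduce to
  boundary fluxes, and weighted sums can be taken by parts.\<close>

lemma exchange_op_flux: "exchange_op a b q n = flux a b q (Suc n) - flux a b q n"
  by (auto simp: exchange_op_def flux_def algebra_simps of_bool_def)

lemma sum_exchange_op: "(\<Sum>n<N. exchange_op a b q n) = flux a b q N"
  by (induction N) (simp_all add: exchange_op_flux, simp add: flux_def)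

lemma abs_flux_le_1:
  assumes "prob_seq q"
  shows "\<bar>flux a b q N\<bar> \<le> 1"
proof -
  have 1: "x * (of_bool P * y) \<in> {0..1}" if "x \<in> {0..1}" "y \<in> {0..1}" for x y :: real and P
    using that by (auto simp: of_bool_def mult_le_one)
  have "lambda_r b q * (of_bool (a < N) * q N) \<in> {0..1}"
    "lambda_g a q * (of_bool (1 \<le> N \<and> N \<le> b) * q (N - 1)) \<in> {0..1}"
    by (rule 1; simp add: assms lambda_bounds prob_seq_nonneg prob_seq_le_1)+
  then show ?thesis
    unfolding flux_def by (auto simp: abs_le_iff)
qed

lemma sum_flux_below:
  assumes "K \<le> a" "a < b"
  shows "(\<Sum>N<K. flux a b q (Suc N)) = - lambda_g a q * (\<Sum>n<K. q n)"
  using assms by (simp add: flux_def sum_distrib_left sum_negf)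

text \<open>Conservation of the mean in truncated form. Up to level \<open>b\<close> the downward
  terms give \<open>lambda_r\<close> times \<open>tail q (a + 1) - tail q (b + 1)\<close>, the
  upward terms give \<open>lambda_g\<close> times \<open>lambda_r\<close>. As
  \<open>lambda_g\<close> is the tail at \<open>a + 1\<close>, these products cancel: every exchange
  moves one unit down and one unit up. Only the mass beyond the truncation is left.\<close>

lemma sum_flux_above:
  assumes q: "prob_seq q" and "a < b" and "b \<le> K"
  shows "(\<Sum>N<K. flux a b q (Suc N)) = - lambda_r b q * tail q (Suc K)"
  using \<open>b \<le> K\<close>
proof (induction K rule: dec_induct)
  case base
  have "(\<Sum>N<b. of_bool (a < Suc N) * q (Suc N)) = (\<Sum>N=a..<b. q (Suc N))"
    by (rule sum.mono_neutral_cong_right) auto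
  also have "\<dots> = (\<Sum>N=a..<b. tail q (Suc N) - tail q (Suc (Suc N)))"
    by (simp add: tail_Suc)
  also have "\<dots> = tail q (Suc a) - tail q (Suc b)"
    using \<open>a < b\<close> by (subst sum_Suc_diff'[where f = "\<lambda>n. - tail q (Suc n)", simplified]) auto
  finally have 1: "(\<Sum>N<b. of_bool (a < Suc N) * q (Suc N)) = tail q (Suc a) - tail q (Suc b)" .
  have "(\<Sum>N<b. of_bool (1 \<le> Suc N \<and> Suc N \<le> b) * q N) = lambda_r b q"
    unfolding lambda_r_def by (intro sum.cong) auto
  then show ?case
    unfolding flux_def sum_subtractf sum_distrib_left[symmetric] diff_Suc_1 1
    by (simp add: lambda_g_tail[OF q] algebra_simps)
next
  case (step K)
  then show ?case using \<open>a < b\<close>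
    by (simp add: flux_def tail_Suc algebra_simps)
qed

text \<open>This total is the coefficient of \<open>ln r - ln g\<close> in the entropy
  estimate.\<close>

lemma sum_flux_between:
  assumes q: "prob_seq q" and "a < b"
  shows "(\<Sum>n=a..<b. flux a b q (Suc n))
    = lambda_g a q * (\<Sum>n<a. q n) - lambda_r b q * tail q (Suc b)"
  using sum_flux_above[OF assms, of b] sum_flux_below[of a a b q] \<open>a < b\<close>
    sum.atLeastLessThan_concat[of 0 a b "\<lambda>n. flux a b q (Suc n)"]
  by (simp add: lessThan_atLeast0)

lemma sum_by_parts_lessThan:
  fixes x :: "nat \<Rightarrow> real"
  shows "(\<Sum>n<K. (real K - real n) * x n) = (\<Sum>N<K. \<Sum>n<Suc N. x n)"
proof (induction K)
  case (Suc K)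
  have "(\<Sum>n<K. (real (Suc K) - real n) * x n) = (\<Sum>n<K. (real K - real n) * x n) + (\<Sum>n<K. x n)"
    by (simp add: algebra_simps flip: sum.distrib)
  then show ?case using Suc by simp
qed simp

section \<open>The equilibrium\<close>

text \<open>Up to normalization, the mean of the weights \<open>r ^ j\<close> on
  \<open>{..m}\<close> minus \<open>d\<close>. With \<open>m = b - a\<close> and
  \<open>d = \<mu> - a\<close> its positive zero is the ratio of the equilibrium.\<close>

definition centred_moment :: "nat \<Rightarrow> nat \<Rightarrow> real \<Rightarrow> real" where
  "centred_moment m d r = (\<Sum>j\<le>m. (real j - real d) * r ^ j)"

text \<open>Divided by \<open>r ^ d\<close>, the centred moment is a sum of terms
  \<open>(j - d) * r ^ (j - d)\<close>, all nondecreasing in \<open>r\<close> and strictly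
  increasing for \<open>j = 0\<close>. The scaled form avoids negative exponents.\<close>

lemma centred_moment_scale_less:
  assumes "0 < d" "0 < r" "r < s"
  shows "(s / r) ^ d * centred_moment m d r < centred_moment m d s"
proof -
  have 1: "1 < s / r" using assms by simp
  have le: "(real j - real d) * (r ^ j * (s / r) ^ d) \<le> (real j - real d) * s ^ j" for j
  proof -
    have "s ^ j = r ^ j * (s / r) ^ j" using assms by (simp add: power_divide)
    moreover have "(real j - real d) * (s / r) ^ d \<le> (real j - real d) * (s / r) ^ j"
    proof (cases "d \<le> j")
      case True
      then show ?thesis using 1 by (intro mult_left_mono power_increasing) auto
    next
      case False
      then show ?thesis using 1 by (intro mult_left_mono_neg power_increasing) auto
    qed
    then have "r ^ j * ((real j - real d) * (s / r) ^ d) \<le> r ^ j * ((real j - real d) * (s / r) ^ j)"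
      by (rule mult_left_mono) (use assms in auto)
    ultimately show ?thesis by (simp only: mult_ac)
  qed
  have "(\<Sum>j\<le>m. (real j - real d) * (r ^ j * (s / r) ^ d)) < (\<Sum>j\<le>m. (real j - real d) * s ^ j)"
  proof (rule sum_strict_mono_ex1)
    have "1 < (s / r) ^ d" using 1 \<open>0 < d\<close> by simp
    then show "\<exists>j\<in>{..m}. (real j - real d) * (r ^ j * (s / r) ^ d) < (real j - real d) * s ^ j"
      using \<open>0 < d\<close> by (intro bexI[of _ 0]) auto
  qed (use le in auto)
  then show ?thesis
    by (simp add: centred_moment_def sum_distrib_left mult_ac)
qed

lemma centred_moment_zero_unique:
  assumes "0 < d" "0 < r" "0 < s" "centred_moment m d r = 0" "centred_moment m d s = 0"
  shows "r = s"
  using centred_moment_scale_less[of d r s m] centred_moment_scale_less[of d s r m] assms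
  by (cases r s rule: linorder_cases) auto

lemma continuous_on_centred_moment: "continuous_on A (centred_moment m d)"
  unfolding centred_moment_def by (intro continuous_intros)

lemma centred_moment_zero_exists:
  assumes "0 < d" "d < m"
  shows "\<exists>r>0. centred_moment m d r = 0"
proof -
  \<comment> \<open>As \<open>R - 1 = m * d\<close>, the top term at \<open>R\<close>, which is at
    least \<open>R ^ (d + 1)\<close>, outweighs the other \<open>m\<close> terms, each at least
    \<open>- (d * R ^ d)\<close>.\<close>
  define R where "R = real m * real d + 1"
  have R: "1 \<le> R" by (simp add: R_def)
  have at_0: "centred_moment m d 0 = - real d"
  proof -
    have "centred_moment m d 0 = (\<Sum>j\<le>m. if j = 0 then - real d else 0)"
      unfolding centred_moment_def by (intro sum.cong) auto
    then show ?thesis by simp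
  qed
  have low: "- (real d * R ^ d) \<le> (real j - real d) * R ^ j" for j
  proof (cases "d \<le> j")
    case True
    then have "0 \<le> (real j - real d) * R ^ j" using R by simp
    moreover have "0 \<le> real d * R ^ d" using R by simp
    ultimately show ?thesis by linarith
  next
    case False
    then have "(real d - real j) * R ^ j \<le> real d * R ^ d"
      using R by (intro mult_mono power_increasing) auto
    then show ?thesis by (simp add: algebra_simps)
  qed
  have "R ^ d * 1 = R ^ Suc d - (\<Sum>j<m. real d * R ^ d)"
  proof -
    have "x = R * x - real m * (real d * x)" for x by (simp add: R_def algebra_simps)
    from this[of "R ^ d"] show ?thesis by simp
  qed
  also have "\<dots> \<le> (real m - real d) * R ^ m + (\<Sum>j<m. (real j - real d) * R ^ j)"
  proof -
    have "R ^ Suc d \<le> R ^ m" using R assms by (intro power_increasing) auto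
    moreover have "1 \<le> real m - real d" using assms by linarith
    ultimately have "1 * R ^ Suc d \<le> (real m - real d) * R ^ m"
      using R by (intro mult_mono) simp_all
    moreover have "(\<Sum>j<m. - (real d * R ^ d)) \<le> (\<Sum>j<m. (real j - real d) * R ^ j)"
      by (intro sum_mono low)
    ultimately show ?thesis by (simp add: sum_negf)
  qed
  also have "\<dots> = centred_moment m d R"
    unfolding centred_moment_def lessThan_Suc_atMost[symmetric] by simp
  finally have "0 \<le> centred_moment m d R"
    using R by (meson mult_nonneg_nonneg order_trans zero_le_one zero_le_power)
  then obtain r where "0 \<le> r" "centred_moment m d r = 0"
    using IVT'[of "centred_moment m d" 0 0 R] at_0 R continuous_on_centred_moment by auto
  moreover from this have "r \<noteq> 0" using at_0 assms by auto
  ultimately show ?thesis by (intro exI[of _ r]) auto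
qed

section \<open>Geometric profiles and uniqueness of the equilibrium\<close>

definition geometric_profile :: "nat \<Rightarrow> nat \<Rightarrow> real \<Rightarrow> real \<Rightarrow> nat \<Rightarrow> real" where
  "geometric_profile a b r c = (\<lambda>n. if a \<le> n \<and> n \<le> b then r ^ (n - a) * c else 0)"

lemma geometric_profile_sums:
  assumes "a \<le> b"
  shows "(\<lambda>n. w n * geometric_profile a b r c n) sums (c * (\<Sum>j\<le>b - a. w (a + j) * r ^ j))"
proof -
  have "(\<lambda>n. w n * geometric_profile a b r c n) sums
      (\<Sum>n=a..b. w n * geometric_profile a b r c n)"
    by (rule sums_finite) (auto simp: geometric_profile_def)
  also have "(\<Sum>n=a..b. w n * geometric_profile a b r c n) = (\<Sum>j\<le>b - a. c * (w (a + j) * r ^ j))"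
    using assms
    by (intro sum.reindex_bij_witness[of _ "\<lambda>j. a + j" "\<lambda>n. n - a"])
      (auto simp: geometric_profile_def)
  finally show ?thesis by (simp add: sum_distrib_left)
qed

text \<open>Once the mass is \<open>1\<close>, the condition on the mean involves \<open>r\<close>
  alone, so \<open>r\<close> and then \<open>c\<close> can be determined in turn.\<close>

lemma geometric_profile_in_V_space_iff:
  assumes "a < \<mu>" "\<mu> < b" "0 < r" "0 < c"
  shows "geometric_profile a b r c \<in> V_space \<mu> \<longleftrightarrow>
    c * (\<Sum>j\<le>b - a. r ^ j) = 1 \<and> centred_moment (b - a) (\<mu> - a) r = 0"
proof -
  let ?s = "\<Sum>j\<le>b - a. r ^ j"
  have mass: "geometric_profile a b r c sums (c * ?s)"
    using geometric_profile_sums[of a b "\<lambda>_. 1" r c] assms by simp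
  have mean: "(\<lambda>n. real n * geometric_profile a b r c n) sums (c * (\<Sum>j\<le>b - a. real (a + j) * r ^ j))"
    using geometric_profile_sums[of a b real r c] assms by simp
  have cm: "(\<Sum>j\<le>b - a. real (a + j) * r ^ j) = centred_moment (b - a) (\<mu> - a) r + real \<mu> * ?s"
    unfolding centred_moment_def sum_distrib_left sum.distrib[symmetric]
    using assms by (intro sum.cong) (auto simp: algebra_simps of_nat_diff)
  have "geometric_profile a b r c \<in> V_space \<mu> \<longleftrightarrow>
      c * ?s = 1 \<and> c * (centred_moment (b - a) (\<mu> - a) r + real \<mu> * ?s) = real \<mu>"
  proof -
    have "geometric_profile a b r c sums 1 \<longleftrightarrow> c * ?s = 1"
      using mass sums_unique2 by metis
    moreover have "(\<lambda>n. real n * geometric_profile a b r c n) sums real \<mu> \<longleftrightarrow>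
        c * (centred_moment (b - a) (\<mu> - a) r + real \<mu> * ?s) = real \<mu>"
      using mean sums_unique2 unfolding cm by metis
    moreover have "0 \<le> geometric_profile a b r c n" for n
      using assms by (simp add: geometric_profile_def)
    ultimately show ?thesis by (simp add: V_space_def prob_seq_def)
  qed
  also have "\<dots> \<longleftrightarrow> c * ?s = 1 \<and> c * centred_moment (b - a) (\<mu> - a) r = 0"
  proof (intro conj_cong refl)
    assume "c * ?s = 1"
    moreover have "c * (X + real \<mu> * ?s) = c * X + real \<mu> * (c * ?s)" for X
      by (simp add: algebra_simps)
    ultimately show "c * (centred_moment (b - a) (\<mu> - a) r + real \<mu> * ?s) = real \<mu>
        \<longleftrightarrow> c * centred_moment (b - a) (\<mu> - a) r = 0"
      by simp
  qed
  finally show ?thesis using assms by simp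
qed

lemma ex1_equilibrium:
  assumes "a < \<mu>" "\<mu> < b"
  shows "\<exists>!q. q \<in> V_space \<mu> \<and> (\<exists>r>0. \<exists>c>0. q = geometric_profile a b r c)"
proof (rule ex_ex1I)
  have "0 < \<mu> - a" "\<mu> - a < b - a" using assms by auto
  then obtain r where r: "0 < r" "centred_moment (b - a) (\<mu> - a) r = 0"
    using centred_moment_zero_exists by blast
  have pos: "0 < (\<Sum>j\<le>b - a. r ^ j)" using r by (intro sum_pos) auto
  then have "geometric_profile a b r (1 / (\<Sum>j\<le>b - a. r ^ j)) \<in> V_space \<mu>"
    using assms r by (subst geometric_profile_in_V_space_iff) auto
  moreover have "0 < 1 / (\<Sum>j\<le>b - a. r ^ j)"
    using pos by simp
  ultimately show "\<exists>q. q \<in> V_space \<mu> \<and> (\<exists>r>0. \<exists>c>0. q = geometric_profile a b r c)"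
    using r by blast
next
  fix q q' :: "nat \<Rightarrow> real"
  assume "q \<in> V_space \<mu> \<and> (\<exists>r>0. \<exists>c>0. q = geometric_profile a b r c)"
    and "q' \<in> V_space \<mu> \<and> (\<exists>r>0. \<exists>c>0. q' = geometric_profile a b r c)"
  then obtain r c r' c' where *: "0 < r" "0 < c" "q = geometric_profile a b r c"
      "0 < r'" "0 < c'" "q' = geometric_profile a b r' c'"
    and V: "c * (\<Sum>j\<le>b - a. r ^ j) = 1" "centred_moment (b - a) (\<mu> - a) r = 0"
      "c' * (\<Sum>j\<le>b - a. r' ^ j) = 1" "centred_moment (b - a) (\<mu> - a) r' = 0"
    using assms geometric_profile_in_V_space_iff by (metis (no_types, lifting))
  have "r = r'" using centred_moment_zero_unique[of "\<mu> - a" r r' "b - a"] * V assms by simp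
  moreover from this have "c = c'" using V 
    by (metis mult_cancel_right mult_zero_right zero_neq_one)
  ultimately show "q = q'" using * by simp
qed

lemma equilibrium_geometric:
  "equilibrium a b \<mu> = (THE q. q \<in> V_space \<mu> \<and> (\<exists>r>0. \<exists>c>0. q = geometric_profile a b r c))"
  by (simp add: equilibrium_def geometric_profile_def)

lemma equilibriumI:
  assumes "a < \<mu>" "\<mu> < b" "geometric_profile a b r c \<in> V_space \<mu>" "0 < r" "0 < c"
  shows "equilibrium a b \<mu> = geometric_profile a b r c"
  unfolding equilibrium_geometric using assms by (intro the1_equality ex1_equilibrium) auto

lemma equilibriumE:
  assumes "a < \<mu>" "\<mu> < b"
  obtains r c where "0 < r" "0 < c" "equilibrium a b \<mu> = geometric_profile a b r c"
    "geometric_profile a b r c \<in> V_space \<mu>"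
  using theI'[OF ex1_equilibrium[OF assms]] that unfolding equilibrium_geometric[symmetric] by auto

text \<open>The mean is rewritten through tails because their evolution is governed by single fluxes
  and is monotone above \<open>b\<close>.\<close>

lemma V_space_iff:
  "q \<in> V_space \<mu> \<longleftrightarrow> prob_seq q \<and> (\<lambda>N. tail q (Suc N)) sums real \<mu>"
  using tail_sums_iff_first_moment by (auto simp: V_space_def)

lemma V_space_prob_seq: "q \<in> V_space \<mu> \<Longrightarrow> prob_seq q"
  by (simp add: V_space_def)

text \<open>Shifting the profile by one site multiplies it by \<open>r\<close>, so
  \<open>lambda_g\<close> is \<open>r\<close> times \<open>lambda_r\<close>. The two directions of
  flow then balance on every bond separately.\<close>

lemma flux_geometric_profile:
  assumes q: "prob_seq (geometric_profile a b r c)" and "a < b"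
  shows "flux a b (geometric_profile a b r c) N = 0"
proof -
  let ?q = "geometric_profile a b r c"
  have "lambda_r b ?q = (\<Sum>l=a..<b. ?q l)"
    unfolding lambda_r_def by (rule sum.mono_neutral_right) (auto simp: geometric_profile_def)
  also have "\<dots> = (\<Sum>j<b - a. ?q (a + j))"
    by (intro sum.reindex_bij_witness[of _ "\<lambda>j. a + j" "\<lambda>n. n - a"]) auto
  finally have r: "lambda_r b ?q = (\<Sum>j<b - a. ?q (a + j))" .
  have "(\<lambda>n. ?q (n + Suc a)) sums (\<Sum>j<b - a. ?q (j + Suc a))"
    by (rule sums_finite) (auto simp: geometric_profile_def)
  then have "lambda_g a ?q = (\<Sum>j<b - a. ?q (j + Suc a))"
    using tail_sums[OF q] lambda_g_tail[OF q] sums_unique2 by metis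
  also have "\<dots> = r * lambda_r b ?q"
    unfolding r sum_distrib_left
    by (intro sum.cong) (auto simp: geometric_profile_def)
  finally have g: "lambda_g a ?q = r * lambda_r b ?q" .
  consider "N \<le> a" | n where "N = Suc n" "a \<le> n" "n < b" | "b < N"
    using less_Suc_eq_le by (cases N) (auto simp: not_le, force)
  then show ?thesis
  proof cases
    case 1
    then show ?thesis by (auto simp: flux_def geometric_profile_def of_bool_def)
  next
    case 2
    then have "?q N = r * ?q (N - 1)" by (simp add: geometric_profile_def Suc_diff_le)
    then show ?thesis using 2 g by (simp add: flux_def)
  next
    case 3
    then show ?thesis by (simp add: flux_def geometric_profile_def)
  qed
qed

text \<open>Vanishing fluxes force consecutive components to have the ratio of the two rates. Total
  mass \<open>1\<close> excludes the zero profile, and uniqueness of the equilibrium does the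
  rest.\<close>

lemma V_space_flux_zero_imp_equilibrium:
  assumes "a < \<mu>" "\<mu> < b" and V: "q \<in> V_space \<mu>"
    and lam: "0 < lambda_r b q" "0 < lambda_g a q"
    and out: "\<And>n. n < a \<or> b < n \<Longrightarrow> q n = 0"
    and flux: "\<And>n. a \<le> n \<Longrightarrow> n < b \<Longrightarrow> flux a b q (Suc n) = 0"
  shows "q = equilibrium a b \<mu>"
proof -
  define r where "r = lambda_g a q / lambda_r b q"
  have step: "q (Suc n) = r * q n" if "a \<le> n" "n < b" for n
    using flux[OF that] that lam by (simp add: flux_def r_def field_simps)
  have pow: "q (a + j) = r ^ j * q a" if "j \<le> b - a" for j
    using that by (induction j) (simp_all add: step)
  have eq: "q = geometric_profile a b r (q a)"
  proof
    fix n
    show "q n = geometric_profile a b r (q a) n"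
      using pow[of "n - a"] out[of n] by (cases "a \<le> n \<and> n \<le> b") (auto simp: geometric_profile_def)
  qed
  have "q a \<noteq> 0"
  proof
    assume "q a = 0"
    then have "q n = 0" for n
      using fun_cong[OF eq, of n] by (simp add: geometric_profile_def)
    then have "q = (\<lambda>_. 0)" by blast
    then show False using V by (simp add: V_space_def prob_seq_def sums_iff)
  qed
  then have "0 < q a" using prob_seq_nonneg[OF V_space_prob_seq[OF V], of a] by simp
  moreover have "0 < r" using lam by (simp add: r_def)
  ultimately show ?thesis using equilibriumI[of a \<mu> b r "q a"] assms eq by metis
qed

text \<open>Markov's inequality for the mass at or above \<open>b\<close>. The bound is positive
  when \<open>\<mu> < b\<close>.\<close>

lemma lambda_r_lower:
  assumes V: "q \<in> V_space \<mu>" and "0 < b"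
  shows "1 - real \<mu> / real b \<le> lambda_r b q"
proof -
  note q = V_space_prob_seq[OF V]
  have "real b * tail q b = (\<Sum>N<b. tail q b)" by simp
  also have "\<dots> \<le> (\<Sum>N<b. tail q (Suc N))"
    by (intro sum_mono tail_antimono q) auto
  also have "\<dots> \<le> real \<mu>"
    using V tail_nonneg[OF q] unfolding V_space_iff
    by (metis sums_iff sum_le_suminf finite_lessThan)
  finally show ?thesis using \<open>0 < b\<close> by (simp add: lambda_r_tail field_simps)
qed

text \<open>The mean alone gives no lower bound: its excess over \<open>a\<close> could be carried
  by a tiny mass very far out. If the levels beyond \<open>K\<close> contribute at most
  \<open>1 / 2\<close>, the remaining excess of at least \<open>1 / 2\<close> comes from fewer than
  or exactly \<open>K\<close> tails, each at most \<open>tail q (a + 1)\<close>.\<close>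

lemma lambda_g_lower:
  assumes V: "q \<in> V_space \<mu>" and "a < \<mu>" "a \<le> K" "0 < K"
    and K: "(\<Sum>N. tail q (Suc (N + K))) \<le> 1 / 2"
  shows "1 / (2 * real K) \<le> lambda_g a q"
proof -
  note q = V_space_prob_seq[OF V]
  have s: "(\<lambda>N. tail q (Suc N)) sums real \<mu>" using V by (simp add: V_space_iff)
  have "real a + 1 \<le> real \<mu>" using \<open>a < \<mu>\<close> by linarith
  also have "real \<mu> = (\<Sum>N. tail q (Suc (N + K))) + (\<Sum>N<K. tail q (Suc N))"
    using suminf_split_initial_segment[OF sums_summable[OF s], of K] s by (simp add: sums_iff)
  also have "(\<Sum>N<K. tail q (Suc N)) = (\<Sum>N<a. tail q (Suc N)) + (\<Sum>N=a..<K. tail q (Suc N))"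
    using sum.atLeastLessThan_concat[of 0 a K "\<lambda>N. tail q (Suc N)"] \<open>a \<le> K\<close>
    by (simp add: lessThan_atLeast0)
  also have "(\<Sum>N<a. tail q (Suc N)) \<le> (\<Sum>N<a. 1)"
    by (intro sum_mono tail_le_1 q)
  also have "(\<Sum>N=a..<K. tail q (Suc N)) \<le> (\<Sum>N=a..<K. tail q (Suc a))"
    by (intro sum_mono tail_antimono q) auto
  also have "\<dots> = real (K - a) * tail q (Suc a)" by simp
  also have "\<dots> \<le> real K * tail q (Suc a)"
    by (intro mult_right_mono tail_nonneg q) auto
  finally have "1 / 2 \<le> real K * tail q (Suc a)" using K by simp
  then show ?thesis using \<open>0 < K\<close> by (simp add: lambda_g_tail[OF q] field_simps)
qed

section \<open>Entropy production and conservation laws\<close>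

lemma mvt_half_line:
  fixes f :: "real \<Rightarrow> real"
  assumes "0 \<le> s" "s < t"
    and "\<And>x. 0 \<le> x \<Longrightarrow> (f has_real_derivative f' x) (at x within {0..})"
  obtains x where "s < x" "x < t" "f t - f s = f' x * (t - s)"
proof -
  have "(f has_derivative (*) (f' x)) (at x within {s..t})" if "s \<le> x" "x \<le> t" for x
    using assms(3)[of x] \<open>0 \<le> s\<close> that unfolding has_field_derivative_def
    by (rule_tac has_derivative_subset[of _ _ _ "{0..}"]) auto
  then obtain x where "x \<in> {s<..<t}" "f t - f s = f' x * (t - s)"
    using mvt_simple[of s t f "\<lambda>x. (*) (f' x)"] \<open>s < t\<close> by blast
  then show thesis using that[of x] by simp
qed

text \<open>The time derivative, in closed form, of the functional \<open>linear_part\<close> that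
  follows.\<close>

definition linear_rate :: "nat \<Rightarrow> nat \<Rightarrow> real \<Rightarrow> (nat \<Rightarrow> real) \<Rightarrow> real" where
  "linear_rate a b k q = flux a b q a - flux a b q (Suc b)
     - k * lambda_r b q * (real b * q (Suc b) + tail q (Suc b))
     - k * lambda_g a q * (\<Sum>n<a. q n)"

text \<open>The infinite sums of the functional are expressed through the conserved mass and mean.\<close>

definition linear_part :: "nat \<Rightarrow> nat \<Rightarrow> nat \<Rightarrow> real \<Rightarrow> (nat \<Rightarrow> real) \<Rightarrow> real" where
  "linear_part a b \<mu> k q = (\<Sum>n<a. q n) + tail q (Suc b)
     + k * (real \<mu> - (\<Sum>n<Suc b. real n * q n)) + k * (\<Sum>n<a. (real a - real n) * q n)"

lemma H_functional_eq:
  assumes "q \<in> V_space \<mu>"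
  shows "H_functional a b k k q = linear_part a b \<mu> k q + (\<Sum>n=a..b. q n * ln (q n))"
proof -
  have "(\<lambda>n. real (n + Suc b) * q (n + Suc b)) sums (real \<mu> - (\<Sum>n<Suc b. real n * q n))"
    using assms sums_iff_shift[of "\<lambda>n. real n * q n" "Suc b"] by (simp add: V_space_def)
  then show ?thesis
    using tail_eq_suminf[OF V_space_prob_seq[OF assms], of "Suc b"]
    unfolding H_functional_def linear_part_def
    by (simp add: sums_iff)
qed

text \<open>Writing \<open>n = (b + 1) - (b + 1 - n)\<close> makes summation by parts from below
  applicable. As the mean is conserved, the right-hand side is the rate at which the first moment
  beyond \<open>b\<close> decreases.\<close>

lemma sum_shifted_exchange_op_above:
  assumes "prob_seq q" "a < b"
  shows "(\<Sum>n<Suc b. real n * exchange_op a b q n)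
    = lambda_r b q * (real b * q (Suc b) + tail q (Suc b))"
proof -
  have "(\<Sum>n<Suc b. real n * exchange_op a b q n) =
      real (Suc b) * (\<Sum>n<Suc b. exchange_op a b q n)
      - (\<Sum>n<Suc b. (real (Suc b) - real n) * exchange_op a b q n)"
    unfolding sum_distrib_left sum_subtractf[symmetric]
    by (intro sum.cong) (auto simp: algebra_simps)
  also have "\<dots> = real (Suc b) * flux a b q (Suc b) - (\<Sum>N<Suc b. flux a b q (Suc N))"
    by (simp only: sum_by_parts_lessThan sum_exchange_op)
  also have "(\<Sum>N<Suc b. flux a b q (Suc N)) = - lambda_r b q * tail q (Suc (Suc b))"
    using assms by (intro sum_flux_above) auto
  also have "flux a b q (Suc b) = lambda_r b q * q (Suc b)"
    using \<open>a < b\<close> by (simp add: flux_def)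
  finally show ?thesis by (simp add: tail_Suc algebra_simps)
qed

lemma sum_shifted_exchange_op_below:
  assumes "a < b"
  shows "(\<Sum>n<a. (real a - real n) * exchange_op a b q n) = - lambda_g a q * (\<Sum>n<a. q n)"
  using sum_flux_below[of a a b q] assms by (simp only: sum_by_parts_lessThan sum_exchange_op)

lemma sum_exchange_op_weighted:
  assumes "a < b"
  shows "(\<Sum>n=a..b. exchange_op a b q n * w n)
    = flux a b q (Suc b) * w b - flux a b q a * w a
      - (\<Sum>n=a..<b. flux a b q (Suc n) * (w (Suc n) - w n))"
proof -
  have "(\<Sum>n=a..a + k. exchange_op a b q n * w n)
    = flux a b q (Suc (a + k)) * w (a + k) - flux a b q a * w a
      - (\<Sum>n=a..<a + k. flux a b q (Suc n) * (w (Suc n) - w n))" for k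
    by (induction k) (simp_all add: exchange_op_flux algebra_simps)
  from this[of "b - a"] show ?thesis using assms by simp
qed

text \<open>The slope of \<open>ln\<close> is at least \<open>1\<close> on \<open>(0, 1]\<close>, so
  differences of logarithms dominate differences of their arguments.\<close>

lemma sq_diff_le_diff_mult_ln_diff:
  fixes x y :: real
  assumes "0 < x" "x \<le> 1" "0 < y" "y \<le> 1"
  shows "(x - y)\<^sup>2 \<le> (x - y) * (ln x - ln y)"
proof -
  have *: "u - v \<le> ln u - ln v" if "0 < v" "v \<le> u" "u \<le> 1" for u v :: real
  proof -
    have "ln (v / u) \<le> v / u - 1" using that by (intro ln_le_minus_one) auto
    moreover have "u - v \<le> (u - v) / u" using that by (intro mult_imp_le_div_pos mult_left_le) auto
    then have "u - v \<le> 1 - v / u" using that by (simp add: diff_divide_distrib)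
    moreover have "ln (v / u) = ln v - ln u" using that by (simp add: ln_div)
    ultimately show ?thesis by linarith
  qed
  show ?thesis
  proof (cases "y \<le> x")
    case True
    then show ?thesis using *[of y x] assms by (simp add: power2_eq_square mult_left_mono)
  next
    case False
    then show ?thesis using *[of x y] assms
      by (simp add: power2_eq_square mult_left_mono_neg)
  qed
qed

text \<open>Inserting the rates into the logarithms makes each bond term a product of the form
  \<open>(x - y) * (ln x - ln y)\<close>, which dominates a squared flux. The price is the remainder
  with \<open>ln r - ln g\<close>, whose coefficient involves only the masses outside
  \<open>[a, b]\<close>, exactly those damped by the weighted terms.\<close>

lemma entropy_production:
  assumes q: "prob_seq q" and ab: "a < b"
    and pos: "\<And>n. a \<le> n \<Longrightarrow> n \<le> b \<Longrightarrow> 0 < q n"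
    and c: "0 < c" "c \<le> lambda_r b q" "c \<le> lambda_g a q"
  shows "linear_rate a b (1 - ln c) q + (\<Sum>n=a..b. exchange_op a b q n * (ln (q n) + 1))
    \<le> - (\<Sum>n=a..<b. (flux a b q (Suc n))\<^sup>2) - c * tail q (Suc b) - c * (\<Sum>n<a. q n)"
proof -
  define r g T A where "r = lambda_r b q" and "g = lambda_g a q"
    and "T = tail q (Suc b)" and "A = (\<Sum>n<a. q n)"
  have rg: "0 < r" "r \<le> 1" "0 < g" "g \<le> 1" "c \<le> r" "c \<le> g"
    using c lambda_bounds[OF q] by (auto simp: r_def g_def intro: less_le_trans)
  have T: "0 \<le> T" and A: "0 \<le> A"
    using tail_nonneg[OF q] prob_seq_nonneg[OF q] by (auto simp: T_def A_def intro: sum_nonneg)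
  let ?F = "\<lambda>n. flux a b q n"
  have F: "?F (Suc n) = r * q (Suc n) - g * q n" if "a \<le> n" "n < b" for n
    using that by (simp add: flux_def r_def g_def)
  have Fa: "?F a \<le> 0" and Fb: "0 \<le> ?F (Suc b)" "?F (Suc b) = r * q (Suc b)"
    using ab lambda_bounds[OF q] prob_seq_nonneg[OF q] by (auto simp: flux_def r_def)
  have lnq: "ln (q n) \<le> 0" if "a \<le> n" "n \<le> b" for n
    using pos[OF that] prob_seq_le_1[OF q] by simp
  have lnr: "ln c \<le> ln r" "ln c \<le> ln g" "ln r \<le> 0" "ln g \<le> 0"
    using rg c by auto
  have "(\<Sum>n=a..<b. (?F (Suc n))\<^sup>2) \<le>
      (\<Sum>n=a..<b. ?F (Suc n) * (ln (q (Suc n)) - ln (q n)) + ?F (Suc n) * (ln r - ln g))"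
  proof (rule sum_mono)
    fix n assume "n \<in> {a..<b}"
    then have n: "a \<le> n" "n < b" "0 < q n" "0 < q (Suc n)" using pos by auto
    have "(?F (Suc n))\<^sup>2 \<le> ?F (Suc n) * (ln (r * q (Suc n)) - ln (g * q n))"
      unfolding F[OF n(1,2)] using rg n prob_seq_le_1[OF q]
      by (intro sq_diff_le_diff_mult_ln_diff) (auto intro: mult_le_one)
    also have "\<dots> = ?F (Suc n) * (ln (q (Suc n)) - ln (q n)) + ?F (Suc n) * (ln r - ln g)"
      using rg n by (simp add: ln_mult algebra_simps)
    finally show "(?F (Suc n))\<^sup>2 \<le> \<dots>" .
  qed
  also have "\<dots> = (\<Sum>n=a..<b. ?F (Suc n) * (ln (q (Suc n)) - ln (q n))) + (g * A - r * T) * (ln r - ln g)"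
    using sum_flux_between[OF q ab]
    by (simp add: sum.distrib sum_distrib_right[symmetric] r_def g_def T_def A_def)
  finally have 1: "- (\<Sum>n=a..<b. ?F (Suc n) * (ln (q (Suc n)) - ln (q n)))
      \<le> (g * A - r * T) * (ln r - ln g) - (\<Sum>n=a..<b. (?F (Suc n))\<^sup>2)"
    by simp
  have 2: "g * A * (ln r - ln g) \<le> g * A * (- ln c)" "r * T * (ln g - ln r) \<le> r * T * (- ln c)"
  proof -
    have "ln r - ln g \<le> - ln c" "ln g - ln r \<le> - ln c" using lnr by linarith+
    then show "g * A * (ln r - ln g) \<le> g * A * (- ln c)" "r * T * (ln g - ln r) \<le> r * T * (- ln c)"
      using rg A T by (intro mult_left_mono; simp)+
  qed
  \<comment> \<open>No mass moves down from \<open>a\<close> and none moves up from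
    \<open>b\<close>, which fixes the signs of the two boundary fluxes; the logarithms are
    nonpositive.\<close>
  have 3: "?F (Suc b) * ln (q b) \<le> 0" "0 \<le> ?F a * ln (q a)"
    using Fa Fb lnq ab by (auto intro: mult_nonneg_nonpos mult_nonpos_nonpos)
  have "0 \<le> (1 - ln c) * (r * (real b * q (Suc b)))"
  proof -
    have "0 \<le> 1 - ln c" using lnr by linarith
    then show ?thesis using rg prob_seq_nonneg[OF q] by simp
  qed
  moreover have "c * T \<le> r * T" "c * A \<le> g * A"
    using rg A T by (auto intro: mult_right_mono)
  \<comment> \<open>The weight is split into \<open>1\<close>, which yields the dissipation of
    \<open>T\<close> and \<open>A\<close>, and \<open>- ln c\<close>, which cancels the bounds in
    \<open>2\<close>.\<close>
  moreover have "linear_rate a b (1 - ln c) q = ?F a - ?F (Suc b)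
      - (1 - ln c) * (r * (real b * q (Suc b))) - (r * T + r * T * (- ln c)) - (g * A + g * A * (- ln c))"
    by (simp add: linear_rate_def r_def g_def T_def A_def algebra_simps)
  \<comment> \<open>The \<open>+ 1\<close> from differentiating the entropy produces boundary fluxes
    that cancel those in \<open>linear_rate\<close>. This is what the unweighted masses in the
    functional are for.\<close>
  moreover have "(\<Sum>n=a..b. exchange_op a b q n * (ln (q n) + 1)) =
      ?F (Suc b) * ln (q b) + ?F (Suc b) - ?F a * ln (q a) - ?F a
      - (\<Sum>n=a..<b. ?F (Suc n) * (ln (q (Suc n)) - ln (q n)))"
    unfolding sum_exchange_op_weighted[OF ab] by (simp add: algebra_simps)
  moreover have "(g * A - r * T) * (ln r - ln g) = g * A * (ln r - ln g) + r * T * (ln g - ln r)"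
    by (simp add: algebra_simps)
  ultimately show ?thesis
    using 1 2 3 unfolding T_def[symmetric] A_def[symmetric] by linarith
qed

section \<open>Conservation of the mean and uniform bounds along a solution\<close>

locale exchange_flow =
  fixes a b \<mu> :: nat and p :: "real \<Rightarrow> nat \<Rightarrow> real"
  assumes a_less: "a < \<mu>" and less_b: "\<mu> < b"
    and solution: "classical_solution a b p"
    and initial: "p 0 \<in> V_space \<mu>"
begin

lemma ab: "a < b"
  using a_less less_b by simp

lemma prob: "0 \<le> t \<Longrightarrow> prob_seq (p t)"
  using solution by (simp add: classical_solution_def)

lemma deriv_p:
  "0 \<le> t \<Longrightarrow> ((\<lambda>s. p s n) has_real_derivative exchange_op a b (p t) n) (at t within {0..})"
  using solution by (simp add: classical_solution_def)

text \<open>As \<open>tail\<close> is \<open>1\<close> minus a finite sum, no limit has to be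
  interchanged with the derivative.\<close>

lemma deriv_tail:
  assumes "0 \<le> t"
  shows "((\<lambda>s. tail (p s) N) has_real_derivative - flux a b (p t) N) (at t within {0..})"
  unfolding tail_def sum_exchange_op[symmetric]
  using assms by (auto intro!: derivative_eq_intros deriv_p)

lemma tail_lipschitz:
  assumes "0 \<le> s" "0 \<le> t"
  shows "\<bar>tail (p t) N - tail (p s) N\<bar> \<le> \<bar>t - s\<bar>"
  using field_differentiable_bound[of "{0..}" "\<lambda>s. tail (p s) N" "\<lambda>t. - flux a b (p t) N" 1 t s]
    deriv_tail abs_flux_le_1[OF prob] assms
  by auto

lemma p_lipschitz:
  assumes "0 \<le> s" "0 \<le> t"
  shows "\<bar>p t n - p s n\<bar> \<le> 2 * \<bar>t - s\<bar>"
  using tail_lipschitz[OF assms, of n] tail_lipschitz[OF assms, of "Suc n"]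
  unfolding tail_Suc by (auto simp: abs_le_iff)

text \<open>No site at or above \<open>b\<close> sends mass up, so mass crosses these levels only
  downward.\<close>

lemma tail_decreasing:
  assumes "b < N" "0 \<le> s" "s \<le> t"
  shows "tail (p t) N \<le> tail (p s) N"
proof (cases "s = t")
  case False
  then have "s < t" using assms by simp
  obtain x where x: "s < x" "x < t" "tail (p t) N - tail (p s) N = - flux a b (p x) N * (t - s)"
    using mvt_half_line[OF \<open>0 \<le> s\<close> \<open>s < t\<close> deriv_tail[of _ N]] by blast
  have "0 \<le> flux a b (p x) N"
    using assms x ab lambda_bounds[OF prob] prob_seq_nonneg[OF prob] by (simp add: flux_def)
  then have "0 \<le> flux a b (p x) N * (t - s)" using assms by simp
  then show ?thesis using x by linarith
qed simp

text \<open>The truncated mean \<open>\<Sum>N<K. tail (p t) (N + 1)\<close> grows at a rate at most \<open>tail (p 0) (K + 1)\<close>,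
  which tends to \<open>0\<close> as \<open>K\<close> grows.\<close>

lemma in_V_space:
  assumes "0 \<le> t"
  shows "p t \<in> V_space \<mu>"
proof (cases "t = 0")
  case False
  have bound: "\<bar>(\<Sum>N<K. tail (p t) (Suc N)) - (\<Sum>N<K. tail (p 0) (Suc N))\<bar> \<le> t * tail (p 0) (Suc K)"
    if "b \<le> K" for K
  proof -
    have deriv: "((\<lambda>s. \<Sum>N<K. tail (p s) (Suc N)) has_real_derivative
        lambda_r b (p x) * tail (p x) (Suc K)) (at x within {0..})" if "0 \<le> x" for x
    proof -
      have "((\<lambda>s. \<Sum>N<K. tail (p s) (Suc N)) has_real_derivative
        (\<Sum>N<K. - flux a b (p x) (Suc N))) (at x within {0..})"
        using that by (intro DERIV_sum deriv_tail)
      then show ?thesis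
        using sum_flux_above[OF prob[OF that] ab \<open>b \<le> K\<close>] by (simp add: sum_negf)
    qed
    have "0 < t" using False assms by simp
    obtain x where x: "0 < x" "(\<Sum>N<K. tail (p t) (Suc N)) - (\<Sum>N<K. tail (p 0) (Suc N))
        = lambda_r b (p x) * tail (p x) (Suc K) * (t - 0)"
      using mvt_half_line[OF order_refl \<open>0 < t\<close> deriv] by blast
    have "0 \<le> lambda_r b (p x) * tail (p x) (Suc K)"
      using x lambda_bounds[OF prob] tail_nonneg[OF prob] by simp
    moreover have "lambda_r b (p x) * tail (p x) (Suc K) \<le> 1 * tail (p 0) (Suc K)"
      using x lambda_bounds[OF prob] tail_nonneg[OF prob] \<open>b \<le> K\<close>
      by (intro mult_mono tail_decreasing) auto
    ultimately show ?thesis using x assms by (simp add: mult.commute mult_left_mono)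
  qed
  have s0: "(\<lambda>N. tail (p 0) (Suc N)) sums real \<mu>"
    using initial by (simp add: V_space_iff)
  have "(\<lambda>K. t * tail (p 0) (Suc K)) \<longlonglongrightarrow> 0"
    using summable_LIMSEQ_zero[OF sums_summable[OF s0]] by (auto intro!: tendsto_eq_intros)
  then have "(\<lambda>K. (\<Sum>N<K. tail (p t) (Suc N)) - (\<Sum>N<K. tail (p 0) (Suc N))) \<longlonglongrightarrow> 0"
    by (rule Lim_null_comparison[rotated])
      (use bound in \<open>auto simp: eventually_sequentially\<close>)
  from tendsto_add[OF this s0[unfolded sums_def]] show ?thesis
    using prob[OF assms] by (simp add: V_space_iff sums_def)
qed (simp add: initial)

text \<open>One \<open>K\<close> serves all times: beyond \<open>b\<close> the tails are dominated
  by their initial values, so their sum from \<open>K\<close> on stays below \<open>1 / 2\<close>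
  once it is so at time \<open>0\<close>. This is the uniform integrability of the mean.\<close>

lemma lambda_lower:
  obtains c where "0 < c" "c < 1" "\<And>t. 0 \<le> t \<Longrightarrow> c \<le> lambda_r b (p t)"
    "\<And>t. 0 \<le> t \<Longrightarrow> c \<le> lambda_g a (p t)"
proof -
  have s: "summable (\<lambda>N. tail (p t) (Suc N))" if "0 \<le> t" for t
    using in_V_space[OF that] by (auto simp: V_space_iff sums_iff)
  obtain K0 where K0: "\<And>K. K0 \<le> K \<Longrightarrow> norm (\<Sum>N. tail (p 0) (Suc (N + K))) < 1 / 2"
    using suminf_exist_split[OF _ s, of "1 / 2" 0] by auto
  define K where "K = max K0 (Suc b)"
  have K: "K0 \<le> K" "b < K" "0 < K" by (auto simp: K_def)
  have g: "1 / (2 * real K) \<le> lambda_g a (p t)" if "0 \<le> t" for t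
  proof (rule lambda_g_lower[OF in_V_space[OF that] a_less])
    have "(\<Sum>N. tail (p t) (Suc (N + K))) \<le> (\<Sum>N. tail (p 0) (Suc (N + K)))"
      using K that s by (intro suminf_le tail_decreasing) (auto simp: summable_iff_shift[of "\<lambda>N. tail _ (Suc N)"])
    then show "(\<Sum>N. tail (p t) (Suc (N + K))) \<le> 1 / 2"
      using K0[OF K(1)] by simp
  qed (use K ab in auto)
  define c where "c = min (1 / (2 * real K)) (1 - real \<mu> / real b)"
  have "0 < c" using K less_b by (simp add: c_def)
  moreover have "c < 1" using K by (simp add: c_def field_simps min_less_iff_disj)
  moreover have "c \<le> lambda_r b (p t)" if "0 \<le> t" for t
    using lambda_r_lower[OF in_V_space[OF that], of b] less_b by (simp add: c_def)
  moreover have "c \<le> lambda_g a (p t)" if "0 \<le> t" for t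
    using g[OF that] by (simp add: c_def)
  ultimately show thesis using that by blast
qed

lemma deriv_linear_part:
  assumes "0 \<le> t"
  shows "((\<lambda>s. linear_part a b \<mu> k (p s)) has_real_derivative linear_rate a b k (p t)) (at t within {0..})"
proof -
  have "((\<lambda>s. linear_part a b \<mu> k (p s)) has_real_derivative
      (\<Sum>n<a. exchange_op a b (p t) n) + (- flux a b (p t) (Suc b))
      + k * (0 - (\<Sum>n<Suc b. real n * exchange_op a b (p t) n))
      + k * (\<Sum>n<a. (real a - real n) * exchange_op a b (p t) n)) (at t within {0..})"
    unfolding linear_part_def
    by (intro DERIV_add DERIV_cmult DERIV_sum DERIV_diff DERIV_const deriv_p deriv_tail assms)
  then show ?thesis
    unfolding sum_shifted_exchange_op_above[OF prob[OF assms] ab] sum_shifted_exchange_op_below[OF ab]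
      sum_exchange_op linear_rate_def
    by (simp add: algebra_simps)
qed

lemma deriv_H:
  assumes "0 \<le> t" and pos: "\<And>n. a \<le> n \<Longrightarrow> n \<le> b \<Longrightarrow> 0 < p t n"
  shows "((\<lambda>s. H_functional a b k k (p s)) has_real_derivative
    linear_rate a b k (p t) + (\<Sum>n=a..b. exchange_op a b (p t) n * (ln (p t n) + 1))) (at t within {0..})"
proof -
  have "((\<lambda>s. p s n * ln (p s n)) has_real_derivative
      exchange_op a b (p t) n * (ln (p t n) + 1)) (at t within {0..})" if "n \<in> {a..b}" for n
  proof -
    have "0 < p t n" using pos that by simp
    then show ?thesis
      using assms(1) by (auto intro!: derivative_eq_intros deriv_p simp: field_simps)
  qed
  then have "((\<lambda>s. linear_part a b \<mu> k (p s) + (\<Sum>n=a..b. p s n * ln (p s n))) has_real_derivative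
    linear_rate a b k (p t) + (\<Sum>n=a..b. exchange_op a b (p t) n * (ln (p t n) + 1))) (at t within {0..})"
    by (intro DERIV_add deriv_linear_part DERIV_sum assms)
  then show ?thesis
    by (rule has_field_derivative_transform_within[OF _ zero_less_one])
      (use assms in \<open>auto simp: H_functional_eq[OF in_V_space]\<close>)
qed

end

section \<open>Positivity\<close>

text \<open>A site loses mass at relative rate at most \<open>2\<close>, since both rates are at
  most \<open>1\<close>. This is the origin of the integrating factor \<open>exp (2 * t)\<close>
  below.\<close>

lemma inflow_le_exchange_op:
  assumes "prob_seq q"
  shows "lambda_r b q * (of_bool (a \<le> n) * q (Suc n)) + lambda_g a q * (of_bool (1 \<le> n \<and> n \<le> b) * q (n - 1))
    \<le> exchange_op a b q n + 2 * q n"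
proof -
  have "x * (of_bool P * q n) \<le> q n" if "0 \<le> x" "x \<le> 1" for x P
    using that prob_seq_nonneg[OF assms, of n] by (auto simp: of_bool_def mult_left_le_one_le)
  from this[OF lambda_bounds(1,2)[OF assms], of b "a + 1 \<le> n"]
    this[OF lambda_bounds(3,4)[OF assms], of a "n + 1 \<le> b"]
  show ?thesis
    unfolding exchange_op_def Suc_eq_plus1 right_diff_distrib by linarith
qed

text \<open>At an empty site only the inflow from the neighbours remains. If it is not positive, the
  neighbours are empty too, and emptiness propagates from \<open>m\<close> through all of
  \<open>[a, b]\<close> and one site beyond.\<close>

lemma gap_of_stationary_zero:
  assumes q: "prob_seq q" and lam: "0 < lambda_r b q" "0 < lambda_g a q"
    and m: "a \<le> m" "m \<le> b" "q m = 0"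
    and stat: "\<And>n. a \<le> n \<Longrightarrow> n \<le> b \<Longrightarrow> q n = 0 \<Longrightarrow> exchange_op a b q n \<le> 0"
    and n: "a \<le> n" "n \<le> b"
  shows "q n = 0 \<and> q (Suc n) = 0 \<and> (1 \<le> n \<longrightarrow> q (n - 1) = 0)"
proof -
  have nb: "q (Suc n) = 0 \<and> (1 \<le> n \<longrightarrow> q (n - 1) = 0)" if "a \<le> n" "n \<le> b" "q n = 0" for n
  proof -
    have "lambda_r b q * q (Suc n) + lambda_g a q * (of_bool (1 \<le> n) * q (n - 1)) \<le> 0"
      using inflow_le_exchange_op[OF q, of b a n] stat[OF that] that by simp
    moreover have "0 \<le> lambda_r b q * q (Suc n)" "0 \<le> lambda_g a q * (of_bool (1 \<le> n) * q (n - 1))"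
      using lam prob_seq_nonneg[OF q] by auto
    ultimately have "lambda_r b q * q (Suc n) = 0" "lambda_g a q * (of_bool (1 \<le> n) * q (n - 1)) = 0"
      by linarith+
    then show ?thesis using lam by auto
  qed
  have "q n = 0"
  proof (cases "m \<le> n")
    case True
    then show ?thesis
      using n
    proof (induction n rule: dec_induct)
      case (step i)
      then show ?case using nb[of i] m by simp
    qed (simp add: m)
  next
    case False
    then have "n \<le> m" by simp
    then show ?thesis
      using n
    proof (induction n rule: inc_induct)
      case (step i)
      then show ?case using nb[of "Suc i"] m by simp
    qed (simp add: m)
  qed
  then show ?thesis using nb n by blast
qed

text \<open>With \<open>y\<close> the fourth root of \<open>x\<close>, the left-hand side is
  \<open>4 * y ^ 3\<close> times \<open>- y * ln y\<close>, and the latter is at most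
  \<open>1\<close>. The power \<open>3 / 4\<close> of a quadratic bound still beats
  \<open>s\<close>.\<close>

lemma neg_mult_ln_le:
  fixes x s :: real
  assumes "0 < x" "x \<le> (2 * s)\<^sup>2" "0 < s"
  shows "- (x * ln x) \<le> s * (8 * sqrt (2 * s))"
proof -
  define y where "y = sqrt (sqrt x)"
  have y: "0 < y" "y\<^sup>2 * y\<^sup>2 = x" using assms by (auto simp: y_def real_sqrt_pow2 simp flip: power2_eq_square)
  have "sqrt x \<le> 2 * s" using assms by (simp add: real_le_lsqrt)
  then have ys: "y \<le> sqrt (2 * s)" "y\<^sup>2 \<le> 2 * s" using assms by (auto simp: y_def)
  have "ln (1 / y) \<le> 1 / y" using y ln_le_minus_one[of "1 / y"] by simp
  then have "- ln y * y \<le> 1" using y by (simp add: ln_div field_simps)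
  moreover have "ln x = 4 * ln y" using y by (simp add: ln_mult ln_realpow flip: y(2))
  ultimately have "- (x * ln x) = (4 * (y\<^sup>2 * y)) * (- ln y * y)"
    using y(2) by (simp add: power2_eq_square flip: y(2))
  also have "\<dots> \<le> (4 * (y\<^sup>2 * y)) * 1"
    using \<open>- ln y * y \<le> 1\<close> y by (intro mult_left_mono) auto
  also have "y\<^sup>2 * y \<le> (2 * s) * sqrt (2 * s)"
    using ys y assms by (intro mult_mono) auto
  finally show ?thesis by simp
qed

section \<open>Strict positivity on the interval at positive times\<close>

context exchange_flow
begin

lemma lambda_pos:
  assumes "0 \<le> t"
  shows "0 < lambda_r b (p t)" "0 < lambda_g a (p t)"
  by (rule lambda_lower; use assms less_le_trans in blast)+

lemma exp_weighted_increment: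
  assumes "0 \<le> s" "s < t"
  obtains x where "s < x" "x < t" "exp (2 * t) * p t n
    = exp (2 * s) * p s n + exp (2 * x) * (exchange_op a b (p x) n + 2 * p x n) * (t - s)"
proof -
  have "((\<lambda>s. exp (2 * s) * p s n) has_real_derivative
      exp (2 * x) * (exchange_op a b (p x) n + 2 * p x n)) (at x within {0..})" if "0 \<le> x" for x
    using that by (auto intro!: derivative_eq_intros deriv_p simp: algebra_simps)
  from mvt_half_line[OF assms this] obtain x where "s < x" "x < t"
    "exp (2 * t) * p t n - exp (2 * s) * p s n = exp (2 * x) * (exchange_op a b (p x) n + 2 * p x n) * (t - s)"
    by blast
  then show thesis using that[of x] by (simp add: algebra_simps)
qed

lemma inflow_nonneg:
  "0 \<le> x \<Longrightarrow> 0 \<le> lambda_r b (p x) * (of_bool (a \<le> n) * p x (Suc n))"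
  "0 \<le> x \<Longrightarrow> 0 \<le> lambda_g a (p x) * (of_bool (1 \<le> n \<and> n \<le> b) * p x (n - 1))"
  using lambda_bounds[OF prob] prob_seq_nonneg[OF prob] by auto

lemma positive_persists:
  assumes "0 \<le> s" "s \<le> t" "0 < p s n"
  shows "0 < p t n"
proof (cases "s = t")
  case False
  then have "s < t" using assms by simp
  obtain x where x: "s < x" "x < t" "exp (2 * t) * p t n
    = exp (2 * s) * p s n + exp (2 * x) * (exchange_op a b (p x) n + 2 * p x n) * (t - s)"
    using exp_weighted_increment[OF \<open>0 \<le> s\<close> \<open>s < t\<close>] by blast
  have "0 \<le> x" using x assms by simp
  then have "0 \<le> exchange_op a b (p x) n + 2 * p x n"
    using inflow_le_exchange_op[OF prob, of x b a n] inflow_nonneg[of x n] by linarith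
  then have "0 \<le> exp (2 * x) * (exchange_op a b (p x) n + 2 * p x n) * (t - s)"
    using x by simp
  moreover have "0 < exp (2 * s) * p s n" using assms by simp
  ultimately have "0 < exp (2 * t) * p t n" using x(3) by linarith
  then show ?thesis by (simp add: zero_less_mult_iff)
qed (use assms in simp)

text \<open>The cases of \<open>nb\<close> are the moves into \<open>n\<close> that the dynamics
  allows. Either one makes the inflow strictly positive at the intermediate time of the mean value
  theorem.\<close>

lemma positive_neighbour:
  assumes pos: "\<And>t. 0 < t \<Longrightarrow> 0 < p t m"
    and nb: "m = Suc n \<and> a \<le> n \<or> n = Suc m \<and> n \<le> b" and "0 < t"
  shows "0 < p t n"
proof -
  have "0 \<le> t / 2" "t / 2 < t" using \<open>0 < t\<close> by auto
  then obtain x where x: "t / 2 < x" "x < t" "exp (2 * t) * p t n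
    = exp (2 * (t / 2)) * p (t / 2) n + exp (2 * x) * (exchange_op a b (p x) n + 2 * p x n) * (t - t / 2)"
    using exp_weighted_increment by blast
  have x0: "0 < x" using x \<open>0 < t\<close> by simp
  have lam: "0 < lambda_r b (p x)" "0 < lambda_g a (p x)"
    using x0 by (auto intro: lambda_pos)
  have "0 < lambda_r b (p x) * (of_bool (a \<le> n) * p x (Suc n))
      + lambda_g a (p x) * (of_bool (1 \<le> n \<and> n \<le> b) * p x (n - 1))"
    using nb pos[OF x0] lam inflow_nonneg[of x n] x0
    by (auto intro: add_pos_nonneg add_nonneg_pos)
  then have "0 < exchange_op a b (p x) n + 2 * p x n"
    using inflow_le_exchange_op[OF prob, of x b a n] x0 by linarith
  then have "0 < exp (2 * x) * (exchange_op a b (p x) n + 2 * p x n) * (t - t / 2)"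
    using \<open>0 < t\<close> by simp
  moreover have "0 \<le> exp (2 * (t / 2)) * p (t / 2) n"
    using prob_seq_nonneg[OF prob] \<open>0 < t\<close> by simp
  ultimately have "0 < exp (2 * t) * p t n" using x(3) by linarith
  then show ?thesis by (simp add: zero_less_mult_iff)
qed

text \<open>Positivity spreads from an initially occupied site \<open>m\<close> to \<open>a\<close>,
  downward or upward, and from \<open>a\<close> up to \<open>b\<close>. The detour through
  \<open>a\<close> also covers \<open>m\<close> outside \<open>[a, b]\<close>.\<close>

lemma positive:
  assumes "a \<le> n" "n \<le> b" "0 < t"
  shows "0 < p t n"
proof -
  have "\<exists>m. p 0 m \<noteq> 0"
  proof (rule ccontr)
    assume "\<not> (\<exists>m. p 0 m \<noteq> 0)"
    then have "p 0 = (\<lambda>_. 0)" by auto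
    then show False using prob[of 0] by (simp add: prob_seq_def sums_iff)
  qed
  then obtain m where "0 < p 0 m"
    using prob_seq_nonneg[OF prob[of 0]] by (metis order_le_less order_refl)
  then have m: "0 < p t m" if "0 < t" for t
    using positive_persists[of 0 t m] that by simp
  have pos_a: "0 < p t a" if "0 < t" for t
  proof (cases "a \<le> m")
    case True
    then have "\<forall>t>0. 0 < p t a"
      by (induction rule: inc_induct) (use m positive_neighbour in blast)+
    then show ?thesis using that by simp
  next
    case False
    then have "m \<le> a" by simp
    then have "\<forall>t>0. 0 < p t a"
    proof (induction rule: dec_induct)
      case (step i)
      then have "Suc i \<le> b" using ab by simp
      then show ?case using step positive_neighbour[of i "Suc i"] by blast
    qed (use m in blast)
    then show ?thesis using that by simp
  qed
  have "n \<le> b \<longrightarrow> (\<forall>t>0. 0 < p t n)"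
    using \<open>a \<le> n\<close>
  proof (induction rule: dec_induct)
    case (step i)
    then show ?case using positive_neighbour[of i "Suc i"] by auto
  qed (use pos_a in blast)
  then show ?thesis using assms by blast
qed

lemma linear_rate_equilibrium:
  assumes "0 \<le> t" "p t = equilibrium a b \<mu>"
  shows "linear_rate a b k (p t) = 0" "exchange_op a b (p t) n = 0"
proof -
  obtain r c where eq: "p t = geometric_profile a b r c"
    using equilibriumE[OF a_less less_b] assms by metis
  have flux: "flux a b (p t) N = 0" for N
    using flux_geometric_profile[of a b r c N] prob[OF assms(1)] ab by (simp add: eq)
  then show "exchange_op a b (p t) n = 0" by (simp add: exchange_op_flux)
  have "tail (p t) (Suc b) = 0"
    using tail_eq_suminf[OF prob[OF assms(1)], of "Suc b"] by (simp add: eq geometric_profile_def)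
  moreover have "(\<Sum>n<a. p t n) = 0" "p t (Suc b) = 0"
    by (auto simp: eq geometric_profile_def)
  ultimately show "linear_rate a b k (p t) = 0" by (simp add: linear_rate_def flux)
qed

lemma mass_split: "(\<Sum>n<a. q n) + (\<Sum>n=a..b. q n) + tail q (Suc b) = 1"
  using sum.atLeastLessThan_concat[of 0 a "Suc b" q] ab
  by (simp add: tail_def lessThan_atLeast0 atLeastLessThanSuc_atLeastAtMost del: sum.lessThan_Suc sum.op_ivl_Suc)

end

section \<open>The derivative of the functional\<close>

lemma tendsto_difference_quotient:
  assumes "(f has_real_derivative D) (at 0 within {0..})"
  shows "((\<lambda>s. (f s - f 0) / s) \<longlongrightarrow> D) (at 0 within {0..})"
  using assms by (simp add: has_field_derivative_iff)

context exchange_flow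
begin

lemma eventually_initial: "(\<And>s. 0 < s \<Longrightarrow> P s) \<Longrightarrow> eventually P (at (0::real) within {0..})"
  by (auto simp: eventually_at_filter)

lemma H_difference_quotient:
  assumes "0 < s"
  shows "(H_functional a b k k (p s) - H_functional a b k k (p 0)) / s =
    (linear_part a b \<mu> k (p s) - linear_part a b \<mu> k (p 0)) / s
    + (\<Sum>n=a..b. (p s n * ln (p s n) - p 0 n * ln (p 0 n)) / s)"
  using assms
  by (simp add: H_functional_eq[OF in_V_space] sum_subtractf flip: sum_divide_distrib)
    (simp add: field_simps)

lemma p_mult_ln_nonpos: "0 \<le> t \<Longrightarrow> p t n * ln (p t n) \<le> 0"
  using prob_seq_nonneg[OF prob, of t n] prob_seq_le_1[OF prob, of t n]
  by (cases "p t n = 0") (auto intro: mult_nonneg_nonpos)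

text \<open>An upper bound is enough to keep this component from compensating another one with slope
  \<open>-\<infinity>\<close>. At an empty site the quotient is even nonpositive.\<close>

lemma entropy_quotient_bounded:
  "\<exists>B. \<forall>\<^sub>F s in at 0 within {0..}. (p s n * ln (p s n) - p 0 n * ln (p 0 n)) / s \<le> B"
proof (cases "p 0 n = 0")
  case True
  then show ?thesis
    using p_mult_ln_nonpos
    by (intro exI[of _ 0] eventually_initial) (simp add: divide_nonpos_pos)
next
  case False
  then have "0 < p 0 n" using prob_seq_nonneg[OF prob[of 0], of n] by simp
  then have "((\<lambda>s. p s n * ln (p s n)) has_real_derivative
      exchange_op a b (p 0) n * (ln (p 0 n) + 1)) (at 0 within {0..})"
    by (auto intro!: derivative_eq_intros deriv_p simp: field_simps)
  from order_tendstoD(2)[OF tendsto_difference_quotient[OF this] less_add_one]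
  show ?thesis by (blast intro: eventually_mono less_imp_le)
qed

text \<open>Component \<open>m\<close> contributes \<open>p s m / s * ln (p s m)\<close>: the first
  factor tends to the positive inflow, the second to \<open>-\<infinity>\<close>. Everything else is
  bounded above.\<close>

lemma H_slope_MInf:
  assumes m: "m \<in> {a..b}" "p 0 m = 0" and inflow: "0 < exchange_op a b (p 0) m"
  shows "has_time_derivative (\<lambda>s. H_functional a b k k (p s)) (-\<infinity>) 0"
proof -
  let ?F = "at 0 within {0::real..}"
  let ?Q = "\<lambda>n s. (p s n * ln (p s n) - p 0 n * ln (p 0 n)) / s"
  let ?L = "\<lambda>s. (linear_part a b \<mu> k (p s) - linear_part a b \<mu> k (p 0)) / s"
  define B where "B n = (SOME B. \<forall>\<^sub>F s in ?F. ?Q n s \<le> B)" for n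
  have B: "\<forall>\<^sub>F s in ?F. ?Q n s \<le> B n" for n
    unfolding B_def by (rule someI_ex) (rule entropy_quotient_bounded)
  have L: "\<forall>\<^sub>F s in ?F. ?L s < linear_rate a b k (p 0) + 1"
    by (rule order_tendstoD(2)[OF tendsto_difference_quotient[OF deriv_linear_part[OF order_refl]] less_add_one])
  define C where "C = linear_rate a b k (p 0) + 1 + (\<Sum>n\<in>{a..b} - {m}. B n)"
  have slope: "((\<lambda>s. p s m / s) \<longlongrightarrow> exchange_op a b (p 0) m) ?F"
    using tendsto_difference_quotient[OF deriv_p[of 0 m]] m by simp
  have "((\<lambda>s. p s m) \<longlongrightarrow> 0) ?F"
    using deriv_p[of 0 m, THEN DERIV_continuous] m by (simp add: continuous_within)
  then have "filterlim (\<lambda>s. p s m) (at_right 0) ?F"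
    unfolding filterlim_at using m positive[of m]
    by (auto intro!: eventually_initial simp: less_imp_neq[symmetric])
  then have "filterlim (\<lambda>s. ln (p s m)) at_bot ?F"
    by (rule filterlim_compose[OF ln_at_0])
  then have "filterlim (\<lambda>s. p s m / s * ln (p s m)) at_bot ?F"
    by (rule filterlim_tendsto_pos_mult_at_bot[OF slope inflow])
  then have "filterlim (\<lambda>s. C + p s m / s * ln (p s m)) at_bot ?F"
    by (simp add: filterlim_tendsto_add_at_bot_iff[OF tendsto_const])
  moreover have "\<forall>\<^sub>F s in ?F. (H_functional a b k k (p s) - H_functional a b k k (p 0)) / s
      \<le> C + p s m / s * ln (p s m)"
  proof -
    have "\<forall>\<^sub>F s in ?F. \<forall>n\<in>{a..b} - {m}. ?Q n s \<le> B n"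
      using B by (simp add: eventually_ball_finite)
    moreover have "\<forall>\<^sub>F s in ?F. 0 < s" by (rule eventually_initial)
    ultimately show ?thesis using L
    proof eventually_elim
      case (elim s)
      have "(\<Sum>n=a..b. ?Q n s) = ?Q m s + (\<Sum>n\<in>{a..b} - {m}. ?Q n s)"
        using m by (simp add: sum.remove)
      also have "\<dots> \<le> p s m / s * ln (p s m) + (\<Sum>n\<in>{a..b} - {m}. B n)"
        using elim m by (intro add_mono sum_mono) auto
      finally show ?case
        using elim unfolding C_def H_difference_quotient[OF \<open>0 < s\<close>] by linarith
    qed
  qed
  ultimately have "filterlim (\<lambda>s. (H_functional a b k k (p s) - H_functional a b k k (p 0)) / s) at_bot ?F"
    by (rule filterlim_at_bot_mono)
  then show ?thesis
    by (simp add: has_time_derivative_def tendsto_MInfty filterlim_at_bot_dense)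
qed

text \<open>A component that vanishes at time \<open>0\<close> with its neighbours is at most \<open>4 s\<^sup>2\<close> at time \<open>s\<close>, which
  makes its entropy \<open>o(s)\<close>.\<close>

lemma entropy_quotient_gap:
  assumes n: "a \<le> n" "n \<le> b" and gap: "p 0 n = 0" "p 0 (Suc n) = 0" "1 \<le> n \<Longrightarrow> p 0 (n - 1) = 0"
  shows "((\<lambda>s. (p s n * ln (p s n) - p 0 n * ln (p 0 n)) / s) \<longlongrightarrow> 0) (at 0 within {0..})"
proof (rule Lim_null_comparison)
  show "((\<lambda>s. 8 * sqrt (2 * s)) \<longlongrightarrow> 0) (at 0 within {0..})"
    by (auto intro!: tendsto_eq_intros)
  have "\<bar>p s n * ln (p s n) / s\<bar> \<le> 8 * sqrt (2 * s)" if "0 < s" for s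
  proof -
    obtain x where x: "0 < x" "x < s" "p s n - p 0 n = exchange_op a b (p x) n * (s - 0)"
      using mvt_half_line[OF order_refl \<open>0 < s\<close> deriv_p[of _ n]] by blast
    note px = prob[OF less_imp_le[OF x(1)]]
    have up: "p x (Suc n) \<le> 2 * s"
      using p_lipschitz[of 0 x "Suc n"] x gap by simp
    have down: "of_bool (1 \<le> n \<and> n \<le> b) * p x (n - 1) \<le> 2 * s"
      using p_lipschitz[of 0 x "n - 1"] x gap by (auto simp: of_bool_def)
    have "exchange_op a b (p x) n \<le> lambda_r b (p x) * (of_bool (a \<le> n) * p x (Suc n))
        + lambda_g a (p x) * (of_bool (1 \<le> n \<and> n \<le> b) * p x (n - 1))"
    proof -
      have "0 \<le> lambda_r b (p x) * (of_bool (a + 1 \<le> n) * p x n)"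
        "0 \<le> lambda_g a (p x) * (of_bool (n + 1 \<le> b) * p x n)"
        using lambda_bounds[OF px] prob_seq_nonneg[OF px] by auto
      then show ?thesis
        unfolding exchange_op_def right_diff_distrib Suc_eq_plus1 by linarith
    qed
    also have "\<dots> \<le> 1 * (2 * s) + 1 * (2 * s)"
      by (rule add_mono; rule mult_mono)
        (use lambda_bounds[OF px] prob_seq_nonneg[OF px] up down n \<open>0 < s\<close> in auto)
    finally have "exchange_op a b (p x) n * (s - 0) \<le> 4 * s * s"
      using \<open>0 < s\<close> by (simp add: mult_right_mono)
    then have "p s n \<le> (2 * s)\<^sup>2" using x gap by (simp add: power2_eq_square)
    then have "- (p s n * ln (p s n)) \<le> s * (8 * sqrt (2 * s))"
      using positive[OF n \<open>0 < s\<close>] \<open>0 < s\<close> by (intro neg_mult_ln_le)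
    moreover have "p s n * ln (p s n) \<le> 0" using p_mult_ln_nonpos \<open>0 < s\<close> by simp
    ultimately have "\<bar>p s n * ln (p s n)\<bar> \<le> s * (8 * sqrt (2 * s))" by linarith
    then show ?thesis
      using \<open>0 < s\<close> unfolding abs_divide by (simp add: pos_divide_le_eq mult_ac)
  qed
  then show "\<forall>\<^sub>F s in at 0 within {0..}.
      norm ((p s n * ln (p s n) - p 0 n * ln (p 0 n)) / s) \<le> 8 * sqrt (2 * s)"
    using gap by (intro eventually_initial) simp
qed

lemma H_deriv_gap:
  assumes gap: "\<And>n. a \<le> n \<Longrightarrow> n \<le> b \<Longrightarrow> p 0 n = 0 \<and> p 0 (Suc n) = 0 \<and> (1 \<le> n \<longrightarrow> p 0 (n - 1) = 0)"
  shows "has_time_derivative (\<lambda>s. H_functional a b k k (p s)) (ereal (linear_rate a b k (p 0))) 0"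
proof -
  let ?F = "at 0 within {0::real..}"
  have "((\<lambda>s. (linear_part a b \<mu> k (p s) - linear_part a b \<mu> k (p 0)) / s
    + (\<Sum>n=a..b. (p s n * ln (p s n) - p 0 n * ln (p 0 n)) / s)) \<longlongrightarrow>
     linear_rate a b k (p 0) + (\<Sum>n=a..b. 0)) ?F"
    using gap
    by (intro tendsto_add tendsto_sum tendsto_difference_quotient deriv_linear_part entropy_quotient_gap) auto
  then have "((\<lambda>s. (H_functional a b k k (p s) - H_functional a b k k (p 0)) / s)
      \<longlongrightarrow> linear_rate a b k (p 0) + (\<Sum>n=a..b. 0)) ?F"
    by (rule Lim_transform_eventually) (intro eventually_initial, simp only: H_difference_quotient)
  then show ?thesis by (simp add: has_time_derivative_def)
qed

text \<open>If all components on \<open>[a, b]\<close> are positive,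
  \<open>entropy_production\<close> decides. Otherwise \<open>t = 0\<close>: either some empty site
  receives mass and the slope is \<open>-\<infinity>\<close>, or all of \<open>[a, b]\<close> is
  empty together with its neighbours. In the latter case the entropy has slope \<open>0\<close>, and
  the linear part decreases strictly because all mass lies outside.\<close>

lemma H_time_derivative:
  assumes c: "0 < c" "c < 1" "\<And>t. 0 \<le> t \<Longrightarrow> c \<le> lambda_r b (p t)"
      "\<And>t. 0 \<le> t \<Longrightarrow> c \<le> lambda_g a (p t)" and "0 \<le> t"
  defines "k \<equiv> 1 - ln c"
  shows "\<exists>D. has_time_derivative (\<lambda>s. H_functional a b k k (p s)) D t \<and>
    (D = -\<infinity> \<longrightarrow> t = 0 \<and> (\<exists>n\<in>{a..b}. p 0 n = 0)) \<and> D \<le> 0 \<and>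
    (D = 0 \<longleftrightarrow> p t = equilibrium a b \<mu>)"
proof (cases "\<forall>n\<in>{a..b}. 0 < p t n")
  case True
  then have pos: "0 < p t n" if "a \<le> n" "n \<le> b" for n using that by simp
  note pt = prob[OF \<open>0 \<le> t\<close>]
  define d where "d = linear_rate a b k (p t) + (\<Sum>n=a..b. exchange_op a b (p t) n * (ln (p t n) + 1))"
  define W where "W = (\<Sum>n=a..<b. (flux a b (p t) (Suc n))\<^sup>2)"
  define A where "A = (\<Sum>n<a. p t n)"
  have W: "0 \<le> W" and A: "0 \<le> A" and T: "0 \<le> tail (p t) (Suc b)"
    using tail_nonneg[OF pt] prob_seq_nonneg[OF pt] by (auto simp: A_def W_def intro: sum_nonneg)
  have "d \<le> - W - c * tail (p t) (Suc b) - c * A"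
    unfolding d_def k_def W_def A_def by (intro entropy_production pt ab pos c \<open>0 \<le> t\<close>)
  moreover have cAT: "0 \<le> c * tail (p t) (Suc b)" "0 \<le> c * A" using A T c by auto
  ultimately have "d \<le> 0" using W by linarith
  have "p t = equilibrium a b \<mu>" if "d = 0"
  proof (rule V_space_flux_zero_imp_equilibrium[OF a_less less_b in_V_space[OF \<open>0 \<le> t\<close>]])
    have "W = 0" "c * tail (p t) (Suc b) = 0" "c * A = 0"
      using \<open>d \<le> - W - c * tail (p t) (Suc b) - c * A\<close> that W cAT by linarith+
    then have z: "W = 0" "tail (p t) (Suc b) = 0" "A = 0" using c by auto
    show "flux a b (p t) (Suc n) = 0" if "a \<le> n" "n < b" for n
      using z(1) that unfolding W_def by (subst (asm) sum_nonneg_eq_0_iff) auto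
    show "p t n = 0" if "n < a \<or> b < n" for n
    proof (cases "n < a")
      case True
      then show ?thesis
        using z(3) prob_seq_nonneg[OF pt] unfolding A_def
        by (subst (asm) sum_nonneg_eq_0_iff) auto
    next
      case False
      then have "tail (p t) n \<le> tail (p t) (Suc b)" using that by (intro tail_antimono pt) auto
      then show ?thesis
        using z(2) prob_seq_le_tail[OF pt, of n] prob_seq_nonneg[OF pt, of n] by linarith
    qed
  qed (use lambda_pos \<open>0 \<le> t\<close> in auto)
  moreover have "d = 0" if "p t = equilibrium a b \<mu>"
    using linear_rate_equilibrium[OF \<open>0 \<le> t\<close> that] by (simp add: d_def)
  moreover have "has_time_derivative (\<lambda>s. H_functional a b k k (p s)) (ereal d) t"
    unfolding has_time_derivative_ereal_iff d_def by (intro deriv_H \<open>0 \<le> t\<close> pos)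
  ultimately show ?thesis using \<open>d \<le> 0\<close> by (intro exI[of _ "ereal d"]) auto
next
  case False
  then obtain m where m: "a \<le> m" "m \<le> b" "\<not> 0 < p t m" by auto
  then have t: "t = 0" using positive[of m t] \<open>0 \<le> t\<close> by (cases "t = 0") auto
  have pm: "p 0 m = 0" using m t prob_seq_nonneg[OF prob, of 0 m] by simp
  have neq: "p t \<noteq> equilibrium a b \<mu>"
  proof
    assume eq: "p t = equilibrium a b \<mu>"
    obtain r c where "0 < r" "0 < c" "equilibrium a b \<mu> = geometric_profile a b r c"
      using equilibriumE[OF a_less less_b] by metis
    then have "0 < p t m" using m unfolding eq by (simp add: geometric_profile_def)
    then show False using m by simp
  qed
  show ?thesis
  proof (cases "\<exists>n\<in>{a..b}. p 0 n = 0 \<and> 0 < exchange_op a b (p 0) n")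
    case True
    then have "has_time_derivative (\<lambda>s. H_functional a b k k (p s)) (-\<infinity>) t"
      using H_slope_MInf t by blast
    then show ?thesis using t m pm neq by (intro exI[of _ "-\<infinity>"]) auto
  next
    case False
    have gap: "p 0 n = 0 \<and> p 0 (Suc n) = 0 \<and> (1 \<le> n \<longrightarrow> p 0 (n - 1) = 0)" if "a \<le> n" "n \<le> b" for n
      using False by (intro gap_of_stationary_zero[OF prob _ _ m(1,2) pm _ that] lambda_pos) (auto simp: not_less)
    define A where "A = (\<Sum>n<a. p 0 n)"
    define T where "T = tail (p 0) (Suc b)"
    have A: "0 \<le> A" and T: "0 \<le> T"
      using tail_nonneg[OF prob] prob_seq_nonneg[OF prob] by (auto simp: A_def T_def intro: sum_nonneg)
    have AT: "A + T = 1"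
      using mass_split[of "p 0"] gap by (simp add: A_def T_def)
    have k: "1 < k" using c by (simp add: k_def)
    \<comment> \<open>Both boundary fluxes vanish: \<open>p 0 (b + 1)\<close> is \<open>0\<close>,
      and so is \<open>p 0 (a - 1)\<close> if \<open>a > 0\<close>, while for \<open>a = 0\<close>
      there is no bond below.\<close>
    have "linear_rate a b k (p 0) = - k * (lambda_r b (p 0) * T + lambda_g a (p 0) * A)"
      using gap[of a] gap[of b] ab
      by (cases a) (simp_all add: linear_rate_def flux_def A_def T_def algebra_simps)
    also have "\<dots> < 0"
    proof -
      have "c * T \<le> lambda_r b (p 0) * T" "c * A \<le> lambda_g a (p 0) * A"
        using A T c by (auto intro: mult_right_mono)
      moreover have "c * T + c * A = c" using AT by (simp flip: distrib_left add: add.commute)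
      ultimately have "0 < lambda_r b (p 0) * T + lambda_g a (p 0) * A" using c by linarith
      then show ?thesis using k by simp
    qed
    finally have "linear_rate a b k (p 0) < 0" .
    then show ?thesis
      using H_deriv_gap[OF gap] t neq by (intro exI[of _ "ereal (linear_rate a b k (p 0))"]) auto
  qed
qed

end

section \<open>Dissipated quantities vanish\<close>

text \<open>An argument of Barbalat type: whenever \<open>J\<close> is large it stays large for a
  fixed time, which costs \<open>h\<close> a fixed amount, and a function bounded below cannot pay
  this indefinitely.\<close>

lemma dissipated_Lipschitz_tendsto_0:
  fixes h h' J :: "real \<Rightarrow> real"
  assumes deriv: "\<And>t. \<tau> \<le> t \<Longrightarrow> (h has_real_derivative h' t) (at t)"
    and dissipation: "\<And>t. \<tau> \<le> t \<Longrightarrow> h' t \<le> - (c * (J t)\<^sup>2)" and "0 < c"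
    and lipschitz: "\<And>s t. \<tau> \<le> s \<Longrightarrow> s \<le> t \<Longrightarrow> \<bar>J t - J s\<bar> \<le> L * (t - s)" and "0 < L"
    and bounded: "\<And>t. \<tau> \<le> t \<Longrightarrow> B \<le> h t"
  shows "(J \<longlongrightarrow> 0) at_top"
proof (rule tendstoI)
  fix e :: real assume "0 < e"
  \<comment> \<open>Within time \<open>d\<close> the function \<open>J\<close> changes by at most
    \<open>e / 2\<close>, and \<open>\<kappa>\<close> is the guaranteed speed of descent of
    \<open>h\<close> while \<open>\<bar>J\<bar>\<close> is at least \<open>e / 2\<close>.\<close>
  define d where "d = e / (2 * L)"
  define \<kappa> where "\<kappa> = c * (e / 2)\<^sup>2"
  have "0 < d" "0 < \<kappa>" using \<open>0 < e\<close> \<open>0 < L\<close> \<open>0 < c\<close> by (auto simp: d_def \<kappa>_def)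
  have decreasing: "h t \<le> h s" if "\<tau> \<le> s" "s \<le> t" for s t
  proof (rule DERIV_nonpos_imp_nonincreasing[OF \<open>s \<le> t\<close>])
    fix x assume "s \<le> x" "x \<le> t"
    then have "\<tau> \<le> x" using that by simp
    moreover have "0 \<le> c * (J x)\<^sup>2" using \<open>0 < c\<close> by simp
    ultimately show "\<exists>y. DERIV h x :> y \<and> y \<le> 0"
      using deriv[of x] dissipation[of x] by (intro exI[of _ "h' x"]) auto
  qed
  have drop: "h (t + d) \<le> h t - \<kappa> * d" if "\<tau> \<le> t" "e \<le> \<bar>J t\<bar>" for t
  proof -
    have "h (t + d) + \<kappa> * (t + d) \<le> h t + \<kappa> * t"
    proof (rule DERIV_nonpos_imp_nonincreasing[where f = "\<lambda>x. h x + \<kappa> * x"])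
      fix x assume x: "t \<le> x" "x \<le> t + d"
      then have "\<bar>J x - J t\<bar> \<le> L * (x - t)" using lipschitz that by simp
      also have "\<dots> \<le> L * d" using x \<open>0 < L\<close> by (intro mult_left_mono) auto
      also have "\<dots> = e / 2" using \<open>0 < L\<close> by (simp add: d_def)
      finally have "e / 2 \<le> \<bar>J x\<bar>" using that by linarith
      then have "(e / 2)\<^sup>2 \<le> (J x)\<^sup>2" using \<open>0 < e\<close> by (simp add: abs_le_square_iff[symmetric])
      then have "\<kappa> \<le> c * (J x)\<^sup>2" using \<open>0 < c\<close> by (simp add: \<kappa>_def)
      moreover have "h' x \<le> - (c * (J x)\<^sup>2)" using dissipation x that by simp
      moreover have "((\<lambda>x. h x + \<kappa> * x) has_real_derivative h' x + \<kappa>) (at x)"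
        using x that by (auto intro!: derivative_eq_intros deriv)
      ultimately show "\<exists>y. DERIV (\<lambda>x. h x + \<kappa> * x) x :> y \<and> y \<le> 0"
        by (intro exI[of _ "h' x + \<kappa>"]) auto
    qed (use \<open>0 < d\<close> in simp)
    then show ?thesis by (simp add: algebra_simps)
  qed
  have bdd: "bdd_below (h ` {\<tau>..})" by (rule bdd_belowI2[of _ B]) (use bounded in simp)
  \<comment> \<open>From a time \<open>t1\<close> at which \<open>h\<close> is this close to its
    infimum, a further drop by \<open>\<kappa> * d\<close> is impossible.\<close>
  have "Inf (h ` {\<tau>..}) < Inf (h ` {\<tau>..}) + \<kappa> * d" using \<open>0 < d\<close> \<open>0 < \<kappa>\<close> by simp
  then obtain t1 where t1: "\<tau> \<le> t1" "h t1 < Inf (h ` {\<tau>..}) + \<kappa> * d"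
    using cInf_lessD[of "h ` {\<tau>..}" "Inf (h ` {\<tau>..}) + \<kappa> * d"] by auto
  have "\<bar>J t\<bar> < e" if "t1 \<le> t" for t
  proof (rule ccontr)
    assume "\<not> \<bar>J t\<bar> < e"
    then have "h (t + d) \<le> h t - \<kappa> * d" using drop t1 that by simp
    also have "h t \<le> h t1" using decreasing t1 that by simp
    also have "h t1 - \<kappa> * d < Inf (h ` {\<tau>..})" using t1 by simp
    also have "\<dots> \<le> h (t + d)" using bdd t1 that \<open>0 < d\<close> by (intro cInf_lower) auto
    finally show False by simp
  qed
  then show "\<forall>\<^sub>F t in at_top. dist (J t) 0 < e"
    by (auto simp: eventually_at_top_linorder)
qed

text \<open>On the part of \<open>K\<close> outside a neighbourhood of the only possible zero,
  \<open>\<bar>f\<bar>\<close> has a positive minimum.\<close>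

lemma tendsto_unique_zero:
  fixes f :: "'a::metric_space \<Rightarrow> real"
  assumes "compact K" "continuous_on K f" and zero: "\<And>x. x \<in> K \<Longrightarrow> f x = 0 \<Longrightarrow> x = r"
    and inK: "\<forall>\<^sub>F t in F. x t \<in> K" and lim: "((\<lambda>t. f (x t)) \<longlongrightarrow> 0) F"
  shows "(x \<longlongrightarrow> r) F"
proof (rule topological_tendstoI)
  fix U assume U: "open U" "r \<in> U"
  show "\<forall>\<^sub>F t in F. x t \<in> U"
  proof (cases "K - U = {}")
    case True
    then show ?thesis using inK by (auto elim: eventually_mono)
  next
    case False
    have "compact (K - U)" using \<open>compact K\<close> U by (simp add: compact_diff)
    moreover have "continuous_on (K - U) (\<lambda>y. \<bar>f y\<bar>)"
      using continuous_on_subset[OF \<open>continuous_on K f\<close>] by (auto intro: continuous_on_rabs)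
    ultimately obtain y where y: "y \<in> K - U" "\<And>z. z \<in> K - U \<Longrightarrow> \<bar>f y\<bar> \<le> \<bar>f z\<bar>"
      using continuous_attains_inf[of "K - U" "\<lambda>y. \<bar>f y\<bar>"] False by blast
    then have "0 < \<bar>f y\<bar>" using zero[of y] U by auto
    from tendstoD[OF lim this] inK show ?thesis
    proof eventually_elim
      case (elim t)
      then show ?case using y(2)[of "x t"] by (cases "x t \<in> U") auto
    qed
  qed
qed

section \<open>Decay of the outer masses and of the fluxes\<close>

context exchange_flow
begin

lemma p_le_sum_below: "0 \<le> t \<Longrightarrow> n < a \<Longrightarrow> p t n \<le> (\<Sum>n<a. p t n)"
  using prob_seq_nonneg[OF prob] by (intro member_le_sum) auto

lemma p_le_tail_above: "0 \<le> t \<Longrightarrow> b < n \<Longrightarrow> p t n \<le> tail (p t) (Suc b)"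
  using prob_seq_le_tail[OF prob, of t n] tail_antimono[OF prob, of t "Suc b" n] by simp

lemma H_bounded_below:
  assumes "0 \<le> t" "0 \<le> k"
  shows "- real (Suc b - a) \<le> H_functional a b k k (p t)"
proof -
  note pt = prob[OF \<open>0 \<le> t\<close>]
  have "- 1 \<le> x * ln x" if "0 \<le> x" for x :: real
  proof (cases "x = 0")
    case False
    then have "0 < x" using that by simp
    then have "ln (1 / x) \<le> 1 / x" using ln_le_minus_one[of "1 / x"] by simp
    then show ?thesis using \<open>0 < x\<close> by (simp add: ln_div field_simps)
  qed simp
  then have "(\<Sum>n=a..b. - 1) \<le> (\<Sum>n=a..b. p t n * ln (p t n))"
    using prob_seq_nonneg[OF pt] by (intro sum_mono) auto
  moreover have "0 \<le> real \<mu> - (\<Sum>n<Suc b. real n * p t n)"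
  proof -
    have "(\<lambda>n. real n * p t n) sums real \<mu>" using in_V_space[OF \<open>0 \<le> t\<close>] by (simp add: V_space_def)
    then have "(\<Sum>n<Suc b. real n * p t n) \<le> real \<mu>"
      using prob_seq_nonneg[OF pt] by (intro sum_le_suminf[of "\<lambda>n. real n * p t n", THEN order_trans])
        (auto simp: sums_iff)
    then show ?thesis by simp
  qed
  then have "0 \<le> linear_part a b \<mu> k (p t)"
    unfolding linear_part_def using prob_seq_nonneg[OF pt] tail_nonneg[OF pt] \<open>0 \<le> k\<close>
    by (intro add_nonneg_nonneg mult_nonneg_nonneg sum_nonneg) auto
  ultimately show ?thesis
    by (simp add: H_functional_eq[OF in_V_space[OF \<open>0 \<le> t\<close>]])
qed

text \<open>The constant \<open>c\<close> is chosen only inside the proof, so \<open>dissip\<close>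
  is asked for every \<open>c\<close> in \<open>(0, 1)\<close>. The number \<open>6\<close> is a
  Lipschitz constant for the fluxes: \<open>1\<close> for a rate plus \<open>2\<close> for a
  component, in each of the two terms. From time \<open>1\<close> on, \<open>[a, b]\<close> is fully
  occupied and derivatives are two-sided.\<close>

lemma dissipation_tendsto_0:
  assumes dissip: "\<And>t c. 1 \<le> t \<Longrightarrow> 0 < c \<Longrightarrow> c < 1 \<Longrightarrow>
      c * (J t)\<^sup>2 \<le> (\<Sum>n=a..<b. (flux a b (p t) (Suc n))\<^sup>2) + c * tail (p t) (Suc b) + c * (\<Sum>n<a. p t n)"
    and lipschitz: "\<And>s t. 0 \<le> s \<Longrightarrow> s \<le> t \<Longrightarrow> \<bar>J t - J s\<bar> \<le> 6 * (t - s)"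
  shows "(J \<longlongrightarrow> 0) at_top"
proof -
  obtain c where c: "0 < c" "c < 1" "\<And>t. 0 \<le> t \<Longrightarrow> c \<le> lambda_r b (p t)"
    "\<And>t. 0 \<le> t \<Longrightarrow> c \<le> lambda_g a (p t)"
    by (rule lambda_lower) blast
  define k where "k = 1 - ln c"
  define h' where "h' t = linear_rate a b k (p t) + (\<Sum>n=a..b. exchange_op a b (p t) n * (ln (p t n) + 1))" for t
  have "0 \<le> k" using c ln_le_minus_one[of c] by (simp add: k_def)
  show ?thesis
  proof (rule dissipated_Lipschitz_tendsto_0[where \<tau> = 1 and h' = h' and c = c and L = 6])
    show "((\<lambda>t. H_functional a b k k (p t)) has_real_derivative h' t) (at t)" if "1 \<le> t" for t
    proof -
      have "at t within {0..} = at t"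
        using that by (intro at_within_open_subset[of _ "{0<..}"]) auto
      then show ?thesis
        using deriv_H[of t k] positive that unfolding h'_def by simp
    qed
    show "h' t \<le> - (c * (J t)\<^sup>2)" if "1 \<le> t" for t
      using entropy_production[of "p t" a b c] prob[of t] ab positive[of _ t] c dissip[OF that c(1,2)] that
      unfolding h'_def k_def by fastforce
    show "- real (Suc b - a) \<le> H_functional a b k k (p t)" if "1 \<le> t" for t
      using H_bounded_below \<open>0 \<le> k\<close> that by simp
  qed (use c lipschitz in auto)
qed

lemma sq_sum_nonneg: "0 \<le> (\<Sum>n=a..<b. (flux a b q (Suc n))\<^sup>2)"
  by (intro sum_nonneg) auto

lemma below_tendsto_0: "((\<lambda>t. \<Sum>n<a. p t n) \<longlongrightarrow> 0) at_top"
proof (rule dissipation_tendsto_0)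
  fix t c :: real assume t: "1 \<le> t" "0 < c" "c < 1"
  define A where "A = (\<Sum>n<a. p t n)"
  have "0 \<le> A" "A \<le> 1"
    using t prob_seq_nonneg[OF prob, of t] tail_nonneg[OF prob, of t a]
    by (auto simp: A_def tail_def intro!: sum_nonneg)
  then have "A\<^sup>2 \<le> A" by (simp add: power2_eq_square mult_left_le)
  then have "c * A\<^sup>2 \<le> c * A" using t by simp
  moreover have "0 \<le> c * tail (p t) (Suc b)" using t tail_nonneg[OF prob] by simp
  ultimately show "c * (\<Sum>n<a. p t n)\<^sup>2
      \<le> (\<Sum>n=a..<b. (flux a b (p t) (Suc n))\<^sup>2) + c * tail (p t) (Suc b) + c * (\<Sum>n<a. p t n)"
    using sq_sum_nonneg[of "p t"] unfolding A_def by linarith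
next
  fix s t :: real assume "0 \<le> s" "s \<le> t"
  then show "\<bar>(\<Sum>n<a. p t n) - (\<Sum>n<a. p s n)\<bar> \<le> 6 * (t - s)"
    using tail_lipschitz[of s t a] by (simp add: tail_def abs_minus_commute)
qed

lemma above_tendsto_0: "((\<lambda>t. tail (p t) (Suc b)) \<longlongrightarrow> 0) at_top"
proof (rule dissipation_tendsto_0)
  fix t c :: real assume t: "1 \<le> t" "0 < c" "c < 1"
  define T where "T = tail (p t) (Suc b)"
  have "0 \<le> T" "T \<le> 1"
    using t tail_nonneg[OF prob] tail_le_1[OF prob] by (auto simp: T_def)
  then have "T\<^sup>2 \<le> T" by (simp add: power2_eq_square mult_left_le)
  then have "c * T\<^sup>2 \<le> c * T" using t by simp
  moreover have "0 \<le> c * (\<Sum>n<a. p t n)"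
    using t prob_seq_nonneg[OF prob, of t] by (auto intro!: mult_nonneg_nonneg sum_nonneg)
  ultimately show "c * (tail (p t) (Suc b))\<^sup>2
      \<le> (\<Sum>n=a..<b. (flux a b (p t) (Suc n))\<^sup>2) + c * tail (p t) (Suc b) + c * (\<Sum>n<a. p t n)"
    using sq_sum_nonneg[of "p t"] unfolding T_def by linarith
next
  fix s t :: real assume "0 \<le> s" "s \<le> t"
  then show "\<bar>tail (p t) (Suc b) - tail (p s) (Suc b)\<bar> \<le> 6 * (t - s)"
    using tail_lipschitz[of s t "Suc b"] by simp
qed

lemma flux_tendsto_0:
  assumes n: "a \<le> n" "n < b"
  shows "((\<lambda>t. flux a b (p t) (Suc n)) \<longlongrightarrow> 0) at_top"
proof (rule dissipation_tendsto_0)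
  fix t c :: real assume t: "1 \<le> t" "0 < c" "c < 1"
  have "c * (flux a b (p t) (Suc n))\<^sup>2 \<le> (flux a b (p t) (Suc n))\<^sup>2"
    using t by (intro mult_left_le_one_le) auto
  also have "\<dots> \<le> (\<Sum>n=a..<b. (flux a b (p t) (Suc n))\<^sup>2)"
    using n by (intro member_le_sum[of n _ "\<lambda>n. (flux a b (p t) (Suc n))\<^sup>2"]) auto
  moreover have "0 \<le> c * tail (p t) (Suc b)" using t tail_nonneg[OF prob] by simp
  moreover have "0 \<le> c * (\<Sum>n<a. p t n)"
    using t prob_seq_nonneg[OF prob, of t] by (auto intro!: mult_nonneg_nonneg sum_nonneg)
  ultimately show "c * (flux a b (p t) (Suc n))\<^sup>2
      \<le> (\<Sum>n=a..<b. (flux a b (p t) (Suc n))\<^sup>2) + c * tail (p t) (Suc b) + c * (\<Sum>n<a. p t n)"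
    by linarith
next
  fix s t :: real assume st: "0 \<le> s" "s \<le> t"
  have *: "\<bar>x * y - x' * y'\<bar> \<le> \<bar>x - x'\<bar> + \<bar>y - y'\<bar>"
    if "0 \<le> y" "y \<le> 1" "0 \<le> x'" "x' \<le> 1" for x y x' y' :: real
  proof -
    have "x * y - x' * y' = (x - x') * y + x' * (y - y')" by (simp add: algebra_simps)
    then have "\<bar>x * y - x' * y'\<bar> \<le> \<bar>x - x'\<bar> * y + x' * \<bar>y - y'\<bar>"
      using abs_triangle_ineq[of "(x - x') * y" "x' * (y - y')"] that by (simp add: abs_mult)
    also have "\<dots> \<le> \<bar>x - x'\<bar> + \<bar>y - y'\<bar>"
      using that by (intro add_mono mult_left_le mult_left_le_one_le) auto
    finally show ?thesis .
  qed
  note ps = prob[OF st(1)] and pt = prob[OF order_trans[OF st]]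
  have "\<bar>lambda_r b (p t) - lambda_r b (p s)\<bar> \<le> t - s"
    using tail_lipschitz[of s t b] st by (simp add: lambda_r_tail abs_minus_commute)
  moreover have "\<bar>lambda_g a (p t) - lambda_g a (p s)\<bar> \<le> t - s"
    using tail_lipschitz[of s t "Suc a"] st by (simp add: lambda_g_tail[OF ps] lambda_g_tail[OF pt])
  moreover have "\<bar>p t m - p s m\<bar> \<le> 2 * (t - s)" for m
    using p_lipschitz[of s t m] st by simp
  moreover have "\<bar>lambda_r b (p t) * p t (Suc n) - lambda_r b (p s) * p s (Suc n)\<bar>
      \<le> \<bar>lambda_r b (p t) - lambda_r b (p s)\<bar> + \<bar>p t (Suc n) - p s (Suc n)\<bar>"
    "\<bar>lambda_g a (p t) * p t n - lambda_g a (p s) * p s n\<bar>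
      \<le> \<bar>lambda_g a (p t) - lambda_g a (p s)\<bar> + \<bar>p t n - p s n\<bar>"
    using lambda_bounds[OF ps] prob_seq_nonneg[OF pt] prob_seq_le_1[OF pt] by (auto intro!: *)
  moreover have "flux a b (p x) (Suc n) = lambda_r b (p x) * p x (Suc n) - lambda_g a (p x) * p x n" for x
    using n by (simp add: flux_def)
  ultimately show "\<bar>flux a b (p t) (Suc n) - flux a b (p s) (Suc n)\<bar> \<le> 6 * (t - s)"
    by (smt (verit))
qed

end

section \<open>Convergence\<close>

context exchange_flow
begin

text \<open>Vanishing mass beyond \<open>b\<close> does not by itself prevent a part of the mean
  from escaping to infinity. Dominated convergence does, with the summable initial tails as
  majorant.\<close>

lemma first_moment_above_tendsto_0:
  "((\<lambda>t. real \<mu> - (\<Sum>n<Suc b. real n * p t n)) \<longlongrightarrow> 0) at_top"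
proof -
  let ?g = "\<lambda>N t. tail (p t) (Suc (N + Suc b))"
  have lim: "((\<lambda>t. ?g N t) \<longlongrightarrow> 0) at_top" for N
  proof (rule tendsto_sandwich[OF _ _ tendsto_const above_tendsto_0])
    show "\<forall>\<^sub>F t in at_top. 0 \<le> ?g N t"
      using eventually_ge_at_top[of 0] by eventually_elim (simp add: tail_nonneg prob)
    show "\<forall>\<^sub>F t in at_top. ?g N t \<le> tail (p t) (Suc b)"
      using eventually_ge_at_top[of 0] by eventually_elim (simp add: tail_antimono prob)
  qed
  have summ: "summable (\<lambda>N. tail (p t) (Suc N))" if "0 \<le> t" for t
    using in_V_space[OF that] by (auto simp: V_space_iff sums_iff)
  have "((\<lambda>t. \<Sum>N. ?g N t) \<longlongrightarrow> (\<Sum>N::nat. 0)) at_top"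
  proof (rule tannerys_theorem[THEN conjunct2, THEN conjunct2])
    have "\<forall>\<^sub>F t in at_top. \<forall>N. norm (?g N t) \<le> ?g N 0"
      using eventually_ge_at_top[of 0]
      by eventually_elim (simp add: tail_nonneg prob tail_decreasing)
    then have "\<forall>\<^sub>F x in at_top \<times>\<^sub>F at_top. \<forall>N. norm (?g N (snd x)) \<le> ?g N 0"
      by (rule eventually_compose_filterlim[OF _ filterlim_snd])
    then show "\<forall>\<^sub>F (N, t) in at_top \<times>\<^sub>F at_top. norm (?g N t) \<le> ?g N 0"
      by (rule eventually_mono) auto
    show "summable (\<lambda>N. ?g N 0)"
      using summ[of 0] by (simp add: summable_iff_shift[of "\<lambda>N. tail (p 0) (Suc N)" "Suc b"] del: add_Suc_right)
  qed (use lim in simp_all)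
  \<comment> \<open>The boundary term of \<open>sum_tail_Suc\<close> at \<open>K = b + 1\<close>,
    needed to pass from tails to the first moment.\<close>
  moreover have "((\<lambda>t. real (Suc b) * tail (p t) (Suc b)) \<longlongrightarrow> 0) at_top"
    using above_tendsto_0 by (auto intro!: tendsto_eq_intros)
  ultimately have "((\<lambda>t. (\<Sum>N. ?g N t) + real (Suc b) * tail (p t) (Suc b)) \<longlongrightarrow> (\<Sum>N::nat. 0) + 0) at_top"
    by (rule tendsto_add)
  moreover have "\<forall>\<^sub>F t in at_top. (\<Sum>N. ?g N t) + real (Suc b) * tail (p t) (Suc b)
      = real \<mu> - (\<Sum>n<Suc b. real n * p t n)"
    using eventually_ge_at_top[of 0]
  proof eventually_elim
    case (elim t)
    have s: "(\<lambda>N. tail (p t) (Suc N)) sums real \<mu>"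
      using in_V_space[OF elim] by (simp add: V_space_iff)
    have "(\<Sum>N. ?g N t) = real \<mu> - (\<Sum>N<Suc b. tail (p t) (Suc N))"
      using suminf_split_initial_segment[OF sums_summable[OF s], of "Suc b"] sums_unique[OF s]
      by linarith
    then show ?case by (simp only: sum_tail_Suc)
  qed
  ultimately have "((\<lambda>t. real \<mu> - (\<Sum>n<Suc b. real n * p t n)) \<longlongrightarrow> (\<Sum>N::nat. 0) + 0) at_top"
    by (rule Lim_transform_eventually)
  then show ?thesis by simp
qed

lemma interval_sum_tendsto_1: "((\<lambda>t. \<Sum>n=a..b. p t n) \<longlongrightarrow> 1) at_top"
proof -
  have "((\<lambda>t. 1 - (\<Sum>n<a. p t n) - tail (p t) (Suc b)) \<longlongrightarrow> 1 - 0 - 0) at_top"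
    by (intro tendsto_intros below_tendsto_0 above_tendsto_0)
  moreover have "1 - (\<Sum>n<a. p t n) - tail (p t) (Suc b) = (\<Sum>n=a..b. p t n)" for t
    using mass_split[of "p t"] by linarith
  ultimately show ?thesis by simp
qed

lemma p_below_tendsto_0:
  assumes "n < a"
  shows "((\<lambda>t. p t n) \<longlongrightarrow> 0) at_top"
proof (rule tendsto_sandwich[OF _ _ tendsto_const below_tendsto_0])
  show "\<forall>\<^sub>F t in at_top. 0 \<le> p t n"
    using eventually_ge_at_top[of 0] by eventually_elim (simp add: prob_seq_nonneg prob)
  show "\<forall>\<^sub>F t in at_top. p t n \<le> (\<Sum>n<a. p t n)"
    using eventually_ge_at_top[of 0] by eventually_elim (simp add: p_le_sum_below assms)
qed

lemma centred_interval_sum_tendsto_0: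
  "((\<lambda>t. \<Sum>n=a..b. (real n - real \<mu>) * p t n) \<longlongrightarrow> 0) at_top"
proof -
  have "((\<lambda>t. real \<mu> - (real \<mu> - (\<Sum>n<Suc b. real n * p t n)) - (\<Sum>n<a. real n * p t n)
      - real \<mu> * (\<Sum>n=a..b. p t n)) \<longlongrightarrow> real \<mu> - 0 - (\<Sum>n<a. real n * 0) - real \<mu> * 1) at_top"
    by (intro tendsto_intros first_moment_above_tendsto_0 interval_sum_tendsto_1 p_below_tendsto_0) simp
  moreover have "(\<Sum>n<Suc b. real n * p t n) = (\<Sum>n<a. real n * p t n) + (\<Sum>n=a..b. real n * p t n)" for t
    using sum.atLeastLessThan_concat[of 0 a "Suc b" "\<lambda>n. real n * p t n"] ab
    by (simp add: lessThan_atLeast0 atLeastLessThanSuc_atLeastAtMost del: sum.lessThan_Suc sum.op_ivl_Suc)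
  ultimately show ?thesis
    by (simp add: left_diff_distrib sum_subtractf sum_distrib_left del: sum.lessThan_Suc)
qed

text \<open>The ratio of consecutive components that vanishing fluxes would enforce at time
  \<open>t\<close>. That it converges is shown only later.\<close>

definition ratio :: "real \<Rightarrow> real" where
  "ratio t = lambda_g a (p t) / lambda_r b (p t)"

lemma ratio_bounds:
  obtains c where "0 < c" "\<And>t. 0 \<le> t \<Longrightarrow> c \<le> ratio t" "\<And>t. 0 \<le> t \<Longrightarrow> ratio t \<le> 1 / c"
proof -
  obtain c where c: "0 < c" "c < 1" "\<And>t. 0 \<le> t \<Longrightarrow> c \<le> lambda_r b (p t)"
    "\<And>t. 0 \<le> t \<Longrightarrow> c \<le> lambda_g a (p t)"
    by (rule lambda_lower) blast
  have "c / 1 \<le> ratio t" if "0 \<le> t" for t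
    unfolding ratio_def using c that lambda_bounds[OF prob] lambda_pos by (intro frac_le) auto
  moreover have "ratio t \<le> 1 / c" if "0 \<le> t" for t
    unfolding ratio_def using c that lambda_bounds[OF prob] by (intro frac_le) auto
  ultimately show thesis using that[of c] c by simp
qed

text \<open>The next defect is the flux divided by \<open>lambda_r\<close> plus \<open>ratio\<close>
  times the current defect. Both coefficients are bounded, so no convergence of \<open>ratio\<close>
  is required.\<close>

lemma geometric_defect_tendsto_0:
  assumes "j \<le> b - a"
  shows "((\<lambda>t. p t (a + j) - ratio t ^ j * p t a) \<longlongrightarrow> 0) at_top"
  using assms
proof (induction j)
  case (Suc j)
  obtain c where c: "0 < c" "c < 1" "\<And>t. 0 \<le> t \<Longrightarrow> c \<le> lambda_r b (p t)"
    by (rule lambda_lower) blast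
  obtain d where d: "0 < d" "\<And>t. 0 \<le> t \<Longrightarrow> d \<le> ratio t" "\<And>t. 0 \<le> t \<Longrightarrow> ratio t \<le> 1 / d"
    by (rule ratio_bounds) blast
  let ?F = "\<lambda>t. flux a b (p t) (Suc (a + j))"
  let ?D = "\<lambda>t. p t (a + j) - ratio t ^ j * p t a"
  have j: "a + j < b" using Suc.prems by simp
  show ?case
  proof (rule Lim_null_comparison)
    show "((\<lambda>t. \<bar>?F t\<bar> / c + 1 / d * \<bar>?D t\<bar>) \<longlongrightarrow> 0) at_top"
    proof -
      have "((\<lambda>t. \<bar>?F t\<bar> / c + 1 / d * \<bar>?D t\<bar>) \<longlongrightarrow> \<bar>0\<bar> / c + 1 / d * \<bar>0\<bar>) at_top"
        using j c(1)
        by (intro tendsto_add tendsto_divide tendsto_mult tendsto_const tendsto_rabs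
            flux_tendsto_0 Suc.IH) auto
      then show ?thesis by simp
    qed
    show "\<forall>\<^sub>F t in at_top. norm (p t (a + Suc j) - ratio t ^ Suc j * p t a) \<le> \<bar>?F t\<bar> / c + 1 / d * \<bar>?D t\<bar>"
      using eventually_ge_at_top[of 0]
    proof eventually_elim
      case (elim t)
      have "p t (a + Suc j) - ratio t ^ Suc j * p t a = ?F t / lambda_r b (p t) + ratio t * ?D t"
        using lambda_pos[OF elim] j by (simp add: flux_def ratio_def field_simps)
      also have "norm \<dots> \<le> \<bar>?F t\<bar> / lambda_r b (p t) + ratio t * \<bar>?D t\<bar>"
        using abs_triangle_ineq[of "?F t / lambda_r b (p t)" "ratio t * ?D t"] lambda_pos[OF elim] d(1) d(2)[OF elim]
        by (simp add: abs_mult)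
      also have "\<dots> \<le> \<bar>?F t\<bar> / c + 1 / d * \<bar>?D t\<bar>"
        using c(1) c(3)[OF elim] d(3)[OF elim] by (intro add_mono mult_right_mono divide_left_mono) auto
      finally show ?case .
    qed
  qed
qed simp

text \<open>Used with the weights \<open>1\<close> and \<open>n - \<mu>\<close>, it turns the limits
  of mass and mean into two relations between \<open>p t a\<close> and
  \<open>ratio t\<close>.\<close>

lemma interval_sum_geometric:
  fixes w :: "nat \<Rightarrow> real"
  assumes "((\<lambda>t. \<Sum>n=a..b. w n * p t n) \<longlongrightarrow> l) at_top"
  shows "((\<lambda>t. p t a * (\<Sum>j\<le>b - a. w (a + j) * ratio t ^ j)) \<longlongrightarrow> l) at_top"
proof -
  have "(\<Sum>n=a..b. w n * p t n) = (\<Sum>j\<le>b - a. w (a + j) * p t (a + j))" for t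
    using ab by (intro sum.reindex_bij_witness[of _ "\<lambda>j. a + j" "\<lambda>n. n - a"]) auto
  with assms have "((\<lambda>t. \<Sum>j\<le>b - a. w (a + j) * p t (a + j)) \<longlongrightarrow> l) at_top" by simp
  moreover have "((\<lambda>t. \<Sum>j\<le>b - a. w (a + j) * (p t (a + j) - ratio t ^ j * p t a)) \<longlongrightarrow>
      (\<Sum>j\<le>b - a. w (a + j) * 0)) at_top"
    by (intro tendsto_sum tendsto_mult tendsto_const geometric_defect_tendsto_0) simp
  ultimately have "((\<lambda>t. (\<Sum>j\<le>b - a. w (a + j) * p t (a + j))
      - (\<Sum>j\<le>b - a. w (a + j) * (p t (a + j) - ratio t ^ j * p t a))) \<longlongrightarrow> l - (\<Sum>j\<le>b - a. w (a + j) * 0)) at_top"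
    by (rule tendsto_diff)
  then show ?thesis
    by (simp add: sum_subtractf[symmetric] sum_distrib_left right_diff_distrib mult_ac)
qed

text \<open>Dividing the mean relation by the mass relation eliminates \<open>p t a\<close>. The
  resulting function \<open>G\<close> of \<open>ratio t\<close> tends to \<open>0\<close>;
  \<open>ratio\<close> stays in a compact interval of positive numbers, where \<open>G\<close>
  vanishes at most at \<open>r\<close>.\<close>

lemma ratio_tendsto:
  assumes "0 < r" "centred_moment (b - a) (\<mu> - a) r = 0"
  shows "(ratio \<longlongrightarrow> r) at_top"
proof -
  obtain d where d: "0 < d" "\<And>t. 0 \<le> t \<Longrightarrow> d \<le> ratio t" "\<And>t. 0 \<le> t \<Longrightarrow> ratio t \<le> 1 / d"
    by (rule ratio_bounds) blast
  define G where "G x = centred_moment (b - a) (\<mu> - a) x / (\<Sum>j\<le>b - a. x ^ j)" for x :: real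
  have pos: "0 < (\<Sum>j\<le>b - a. x ^ j)" if "0 < x" for x :: real
    using that by (intro sum_pos) auto
  have mass: "((\<lambda>t. p t a * (\<Sum>j\<le>b - a. ratio t ^ j)) \<longlongrightarrow> 1) at_top"
    using interval_sum_geometric[of "\<lambda>_. 1"] interval_sum_tendsto_1 by simp
  have "((\<lambda>t. p t a * centred_moment (b - a) (\<mu> - a) (ratio t)) \<longlongrightarrow> 0) at_top"
    using interval_sum_geometric[OF centred_interval_sum_tendsto_0] a_less
    by (simp add: centred_moment_def of_nat_diff algebra_simps)
  from tendsto_divide[OF this mass] have
    "((\<lambda>t. p t a * centred_moment (b - a) (\<mu> - a) (ratio t) / (p t a * (\<Sum>j\<le>b - a. ratio t ^ j))) \<longlongrightarrow> 0) at_top"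
    by simp
  moreover have "\<forall>\<^sub>F t in at_top. p t a * centred_moment (b - a) (\<mu> - a) (ratio t) / (p t a * (\<Sum>j\<le>b - a. ratio t ^ j))
      = G (ratio t)"
    using eventually_gt_at_top[of 0]
  proof eventually_elim
    case (elim t)
    then have "0 < p t a" using positive ab by simp
    then show ?case by (simp add: G_def)
  qed
  ultimately have lim: "((\<lambda>t. G (ratio t)) \<longlongrightarrow> 0) at_top"
    by (rule Lim_transform_eventually)
  show ?thesis
  proof (rule tendsto_unique_zero[where f = G and x = ratio, OF compact_Icc _ _ _ lim])
    show "continuous_on {d..1 / d} G"
    proof -
      have "(\<Sum>j\<le>b - a. x ^ j) \<noteq> 0" if "x \<in> {d..1 / d}" for x
      proof -
        have "0 < x" using that d(1) by simp
        then show ?thesis using pos[of x] by simp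
      qed
      then show ?thesis
        unfolding G_def by (intro continuous_on_divide continuous_on_centred_moment continuous_intros) blast
    qed
    show "x = r" if "x \<in> {d..1 / d}" "G x = 0" for x
    proof -
      have "0 < x" using that d(1) by simp
      then have "centred_moment (b - a) (\<mu> - a) x = 0" using that pos[of x] by (simp add: G_def)
      then show ?thesis
        using centred_moment_zero_unique[of "\<mu> - a" x r "b - a"] \<open>0 < x\<close> assms a_less by simp
    qed
    show "\<forall>\<^sub>F t in at_top. ratio t \<in> {d..1 / d}"
      using eventually_ge_at_top[of 0] by eventually_elim (simp add: d)
  qed
qed

lemma p_tendsto_equilibrium: "((\<lambda>t. p t n) \<longlongrightarrow> equilibrium a b \<mu> n) at_top"
proof -
  obtain r c where rc: "0 < r" "0 < c" "equilibrium a b \<mu> = geometric_profile a b r c"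
    "geometric_profile a b r c \<in> V_space \<mu>"
    by (rule equilibriumE[OF a_less less_b])
  then have c: "c * (\<Sum>j\<le>b - a. r ^ j) = 1" and r: "centred_moment (b - a) (\<mu> - a) r = 0"
    using geometric_profile_in_V_space_iff[OF a_less less_b] by auto
  note ratio = ratio_tendsto[OF \<open>0 < r\<close> r]
  have pos: "0 < (\<Sum>j\<le>b - a. r ^ j)" using rc by (intro sum_pos) auto
  obtain d where d: "0 < d" "\<And>t. 0 \<le> t \<Longrightarrow> d \<le> ratio t"
    by (rule ratio_bounds) blast
  have mass: "((\<lambda>t. p t a * (\<Sum>j\<le>b - a. ratio t ^ j)) \<longlongrightarrow> 1) at_top"
    using interval_sum_geometric[of "\<lambda>_. 1"] interval_sum_tendsto_1 by simp
  have "((\<lambda>t. p t a * (\<Sum>j\<le>b - a. ratio t ^ j) / (\<Sum>j\<le>b - a. ratio t ^ j)) \<longlongrightarrow> 1 / (\<Sum>j\<le>b - a. r ^ j)) at_top"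
    using pos by (intro tendsto_divide mass tendsto_sum tendsto_power ratio) auto
  also have "1 / (\<Sum>j\<le>b - a. r ^ j) = c" using c pos by (simp add: field_simps)
  finally have lim_a: "((\<lambda>t. p t a) \<longlongrightarrow> c) at_top"
  proof (rule Lim_transform_eventually)
    show "\<forall>\<^sub>F t in at_top. p t a * (\<Sum>j\<le>b - a. ratio t ^ j) / (\<Sum>j\<le>b - a. ratio t ^ j) = p t a"
      using eventually_ge_at_top[of 0]
    proof eventually_elim
      case (elim t)
      have "0 < ratio t" using d(1) d(2)[OF elim] by simp
      then have "0 < (\<Sum>j\<le>b - a. ratio t ^ j)" by (intro sum_pos) auto
      then show ?case by simp
    qed
  qed
  consider "n < a" | "b < n" | "a \<le> n" "n \<le> b" by linarith
  then show ?thesis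
  proof cases
    case 1
    then show ?thesis using p_below_tendsto_0 by (simp add: rc(3) geometric_profile_def)
  next
    case 2
    have "((\<lambda>t. p t n) \<longlongrightarrow> 0) at_top"
    proof (rule tendsto_sandwich[OF _ _ tendsto_const above_tendsto_0])
      show "\<forall>\<^sub>F t in at_top. 0 \<le> p t n"
        using eventually_ge_at_top[of 0] by eventually_elim (simp add: prob_seq_nonneg prob)
      show "\<forall>\<^sub>F t in at_top. p t n \<le> tail (p t) (Suc b)"
        using eventually_ge_at_top[of 0] by eventually_elim (simp add: p_le_tail_above 2)
    qed
    then show ?thesis using 2 by (simp add: rc(3) geometric_profile_def)
  next
    case 3
    have "((\<lambda>t. (p t (a + (n - a)) - ratio t ^ (n - a) * p t a) + ratio t ^ (n - a) * p t a)
        \<longlongrightarrow> 0 + r ^ (n - a) * c) at_top"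
      using 3 by (intro tendsto_add geometric_defect_tendsto_0 tendsto_mult tendsto_power ratio lim_a) simp
    then show ?thesis using 3 by (simp add: rc(3) geometric_profile_def)
  qed
qed

text \<open>All differences are at most \<open>1\<close>, so their powers with exponent
  \<open>q > 1\<close> are bounded by the differences themselves. The summed distance consists of
  finitely many components, each convergent, and the tail beyond \<open>b\<close>, where the
  equilibrium vanishes.\<close>

lemma lp_tendsto_equilibrium:
  assumes "1 < q"
  shows "lp_tendsto q p (equilibrium a b \<mu>)"
proof -
  define e where "e = equilibrium a b \<mu>"
  obtain r c where rc: "e = geometric_profile a b r c" "geometric_profile a b r c \<in> V_space \<mu>"
    unfolding e_def by (rule equilibriumE[OF a_less less_b])
  have e: "prob_seq e" using rc V_space_prob_seq by simp
  have e0: "e n = 0" if "b < n" for n using that by (simp add: rc geometric_profile_def)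
  have powr_le: "\<bar>x\<bar> powr q \<le> \<bar>x\<bar>" if "\<bar>x\<bar> \<le> 1" for x
    using that assms powr_mono'[of 1 q "\<bar>x\<bar>"] by simp
  have in_lp: "x \<in> lp_space q" if "prob_seq x" for x
    unfolding lp_space_def mem_Collect_eq
  proof (rule summable_comparison_test')
    show "summable x" using that by (auto simp: prob_seq_def sums_iff)
    show "norm (\<bar>x n\<bar> powr q) \<le> x n" for n
      using powr_le[of "x n"] prob_seq_nonneg[OF that, of n] prob_seq_le_1[OF that, of n] by simp
  qed
  let ?f = "\<lambda>t n. \<bar>p t n - e n\<bar>"
  let ?B = "\<lambda>t. (\<Sum>n<Suc b. ?f t n) + tail (p t) (Suc b)"
  have bound: "0 \<le> (\<Sum>n. ?f t n powr q)" "(\<Sum>n. ?f t n powr q) \<le> ?B t" if "0 \<le> t" for t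
  proof -
    note pt = prob[OF that]
    have "?f t (n + Suc b) = p t (n + Suc b)" for n
      using e0 prob_seq_nonneg[OF pt] by simp
    then have f: "?f t sums ?B t"
      using sums_iff_shift[of "?f t" "Suc b" "tail (p t) (Suc b)"] tail_sums[OF pt, of "Suc b"]
      by (simp add: add.commute)
    have le: "?f t n powr q \<le> ?f t n" for n
      using prob_seq_nonneg[OF pt, of n] prob_seq_le_1[OF pt, of n]
        prob_seq_nonneg[OF e, of n] prob_seq_le_1[OF e, of n]
      by (intro powr_le) (simp add: abs_le_iff)
    then have s: "summable (\<lambda>n. ?f t n powr q)"
      by (intro summable_comparison_test'[OF sums_summable[OF f]]) auto
    show "0 \<le> (\<Sum>n. ?f t n powr q)" using s by (intro suminf_nonneg) auto
    show "(\<Sum>n. ?f t n powr q) \<le> ?B t"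
      using suminf_le[OF le s sums_summable[OF f]] f by (simp add: sums_iff)
  qed
  have "((\<lambda>t. ?B t) \<longlongrightarrow> (\<Sum>n<Suc b. \<bar>e n - e n\<bar>) + 0) at_top"
    by (intro tendsto_add tendsto_sum tendsto_rabs tendsto_diff tendsto_const above_tendsto_0
        p_tendsto_equilibrium[folded e_def])
  then have B: "(?B \<longlongrightarrow> 0) at_top" by simp
  have nonneg: "\<forall>\<^sub>F t in at_top. 0 \<le> (\<Sum>n. ?f t n powr q)"
    using eventually_ge_at_top[of 0] by eventually_elim (rule bound)
  have "((\<lambda>t. \<Sum>n. ?f t n powr q) \<longlongrightarrow> 0) at_top"
  proof (rule tendsto_sandwich[OF nonneg _ tendsto_const B])
    show "\<forall>\<^sub>F t in at_top. (\<Sum>n. ?f t n powr q) \<le> ?B t"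
      using eventually_ge_at_top[of 0] by eventually_elim (rule bound)
  qed
  then have "((\<lambda>t. lp_norm q (\<lambda>n. p t n - e n)) \<longlongrightarrow> 0) at_top"
    unfolding lp_norm_def
    by (rule tendsto_zero_powrI[OF _ tendsto_const nonneg]) (use assms in simp)
  then show ?thesis
    unfolding lp_tendsto_def e_def[symmetric] using in_lp e prob by blast
qed

end

theorem theorem2:
  fixes a b \<mu> :: nat and p :: "real \<Rightarrow> nat \<Rightarrow> real"
  assumes "a < \<mu>" and "\<mu> < b"
    and "classical_solution a b p"
    and "p 0 \<in> A_space \<mu>"
  shows "(\<exists>k1>0. \<exists>k2>0. \<forall>t\<ge>0. \<exists>D.
            has_time_derivative (\<lambda>s. H_functional a b k1 k2 (p s)) D t \<and>
            (D = -\<infinity> \<longrightarrow> t = 0 \<and> (\<exists>n\<in>{a..b}. p 0 n = 0)) \<and>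
            D \<le> 0 \<and>
            (D = 0 \<longleftrightarrow> p t = equilibrium a b \<mu>))
       \<and> (\<forall>q>1. lp_tendsto q p (equilibrium a b \<mu>))"
proof -
  interpret exchange_flow a b \<mu> p
    using assms by unfold_locales (auto simp: A_space_def)
  obtain c where c: "0 < c" "c < 1" "\<And>t. 0 \<le> t \<Longrightarrow> c \<le> lambda_r b (p t)"
    "\<And>t. 0 \<le> t \<Longrightarrow> c \<le> lambda_g a (p t)"
    by (rule lambda_lower) blast
  have "0 < 1 - ln c" using c ln_le_minus_one[of c] by simp
  moreover note H_time_derivative[OF c]
  ultimately show ?thesis
    using lp_tendsto_equilibrium by blast
qed

end
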